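(* Let $p_1,p_2,p_3,p_4:\mathbb{R}\to\mathbb{C}$ be $\pi$-periodic, locally integrable functions with $\overline{p_j(-x)}=p_j(x)$ for $j=1,2,3,4$, and let $P=\begin{pmatrix}p_1&p_2\\ p_3&p_4\end{pmatrix}$. Let $$\gamma=\frac1{2\pi}\int_0^\pi\bigl(p_1(x)+p_4(x)\bigr)\,dx$$ (a real number), let $\widetilde P$ be the off-diagonal matrix associated with $P$ in the context, and let $\{\varepsilon_k\}$ be a sequence and $N$ a positive constant for $\widetilde P$ as described in the context. Then for every integer $k$ with $|k|>N$ the intervals $$(2k+\varepsilon_k+\gamma,\ 2k+1-\varepsilon_k+\gamma)\quad\text{and}\quad(2k+1+\varepsilon_k+\gamma,\ 2k+2-\varepsilon_k+\gamma)$$ belong to the spectrum $\sigma(L(P))$ of the operator $L(P)$, and $$\lim_{s\to\infty}\frac{\mu\bigl(\sigma(L(P))\cap(-2s,2s)\bigr)}{4s}=1 .$$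
   Context: For a $\pi$-periodic, locally integrable $2\times2$ matrix function $Q$, $L(Q)$ is the operator generated in $L_2^2(-\infty,\infty)$ (square-integrable $\mathbb{C}^2$-valued functions on $\mathbb{R}$) by the Dirac expression $\begin{pmatrix}-i&0\\ 0&i\end{pmatrix}\mathbf{y}'(x)+Q(x)\mathbf{y}(x)$. For $t\in[0,2)$, $L_t(Q)$ is the operator generated in $L_2^2[0,\pi]$ by the same expression and the boundary condition $\mathbf{y}(\pi)=e^{i\pi t}\mathbf{y}(0)$. It is well known that $\sigma(L(Q))=\bigcup_{t\in[0,2)}\sigma(L_t(Q))$. $\mu$ denotes Lebesgue measure on $\mathbb{R}$, and $(-2s,2s)$ is a real interval. Associated off-diagonal matrix: put $\varphi(x)=\gamma x-\int_0^xp_1(s)\,ds$, $\psi(x)=\int_0^xp_4(s)\,ds-\gamma x$, and $$\widetilde P=\begin{pmatrix}0&\widetilde p_2\\ \widetilde p_3&0\end{pmatrix},\qquad \widetilde p_2(x)=p_2(x)e^{i(\psi(x)-\varphi(x))},\qquad \widetilde p_3(x)=p_3(x)e^{i(\varphi(x)-\psi(x))}.$$ The function $f$: let $E(x,\lambda)=(e_{ij}(x,\lambda))_{i,j=1}^2$ be the fundamental matrix of $\begin{pmatrix}-i&0\\ 0&i\end{pmatrix}\mathbf{y}'+\widetilde P\mathbf{y}=\lambda\mathbf{y}$ with $E(0,\lambda)=I$. The eigenvalues of $L_t(\widetilde P)$ are the roots of $\Delta(\lambda,t)=\det(E(\pi,\lambda)-e^{i\pi t}I)=0$, and $\Delta(\lambda,t)=e^{i2\pi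 t}-2e^{i\pi t}\cos\pi\lambda+1+o(1)$ as $\lambda\to\infty$ in a strip $|\operatorname{Im}\lambda|<a$ ($a$ fixed). Accordingly, the eigenvalues of $L_t(\widetilde P)$ in this strip are the roots of $\cos\pi\lambda-\cos\pi t+e^{-i\pi t}f(\lambda)=0$, where $f$ is an entire function with $f(\lambda)\to0$ as $\lambda\to\infty$, $|\operatorname{Im}\lambda|<a$. The sequence $\{\varepsilon_k\}$: $\{\varepsilon_k\}$ and $\{\delta_k\}$ ($k\in\mathbb{Z}$) are sequences of positive numbers with $\varepsilon_k\to0$, $\delta_k\to0$ as $|k|\to\infty$ such that, for all $|k|$ sufficiently large, $\frac92\varepsilon_k^2>\delta_k$ and $|f(\lambda)|<\delta_k$ for all $\lambda$ with $\operatorname{Re}\lambda\in[2k,2k+2]$, $|\operatorname{Im}\lambda|\le\varepsilon_k$. The constant $N$: a positive constant such that for every integer $k$ with $|k|>N$ and every $t\in T(k):=[\varepsilon_k,1-\varepsilon_k]\cup[1+\varepsilon_k,2-\varepsilon_k]$, the operator $L_t(\widetilde P)$ has a unique eigenvalue, counting multiplicities, inside each of the circles $C(2k+t,\varepsilon_k)$ and $C(2k-t,\varepsilon_k)$, where $C(c,\varepsilon)=\{\mu\in\mathbb{C}:|\mu-c|=\varepsilon\}$.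
   Formalization: The constant N is required, besides isolating the eigenvalues, to be so large that for all |k|>N the estimates (9/2)ε_k²>δ_k and |f|<δ_k hold and ε_k≤1/3; with the isolation property alone the interval claim fails, e.g. p1=p4=0, p2=ce^{4ix}, p3=ce^{-4ix}, k=1. *)

theory Defs
  imports "HOL-Analysis.Analysis"
begin

section \<open>Potentials\<close>

definition mat2 :: "complex \<Rightarrow> complex \<Rightarrow> complex \<Rightarrow> complex \<Rightarrow> complex^2^2" where
  "mat2 a b c d = vector [vector [a, b], vector [c, d]]"

definition loc_integrable :: "(real \<Rightarrow> complex) \<Rightarrow> bool" where
  "loc_integrable p \<longleftrightarrow> (\<forall>a b. p absolutely_integrable_on {a..b})"

text \<open>The oriented integral of \<open>p\<close> from \<open>0\<close> to \<open>x\<close>. The interval integral of the library is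
  taken with respect to \<open>lborel\<close> and would vanish for functions that are Lebesgue but not Borel
  measurable, so the gauge integral is used instead.\<close>

definition integral_from_0 :: "(real \<Rightarrow> complex) \<Rightarrow> real \<Rightarrow> complex" where
  "integral_from_0 p x = (if 0 \<le> x then integral {0..x} p else - integral {x..0} p)"

definition gam :: "(real \<Rightarrow> complex) \<Rightarrow> (real \<Rightarrow> complex) \<Rightarrow> complex" where
  "gam p1 p4 = integral {0..pi} (\<lambda>x. p1 x + p4 x) / (2 * of_real pi)"

definition phase1 :: "(real \<Rightarrow> complex) \<Rightarrow> (real \<Rightarrow> complex) \<Rightarrow> real \<Rightarrow> complex" where
  "phase1 p1 p4 x = gam p1 p4 * of_real x - integral_from_0 p1 x"

definition phase2 :: "(real \<Rightarrow> complex) \<Rightarrow> (real \<Rightarrow> complex) \<Rightarrow> real \<Rightarrow> complex" where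
  "phase2 p1 p4 x = integral_from_0 p4 x - gam p1 p4 * of_real x"

definition potential ::
  "(real \<Rightarrow> complex) \<Rightarrow> (real \<Rightarrow> complex) \<Rightarrow> (real \<Rightarrow> complex) \<Rightarrow> (real \<Rightarrow> complex)
     \<Rightarrow> real \<Rightarrow> complex^2^2" where
  "potential p1 p2 p3 p4 x = mat2 (p1 x) (p2 x) (p3 x) (p4 x)"

definition offdiag_potential ::
  "(real \<Rightarrow> complex) \<Rightarrow> (real \<Rightarrow> complex) \<Rightarrow> (real \<Rightarrow> complex) \<Rightarrow> (real \<Rightarrow> complex)
     \<Rightarrow> real \<Rightarrow> complex^2^2" where
  "offdiag_potential p1 p2 p3 p4 x =
     mat2 0 (p2 x * exp (\<i> * (phase2 p1 p4 x - phase1 p1 p4 x)))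
          (p3 x * exp (\<i> * (phase1 p1 p4 x - phase2 p1 p4 x))) 0"


section \<open>Operators in spaces of square-integrable functions\<close>

text \<open>Elements of the Hilbert space are represented by functions, two functions being identified
  if they agree almost everywhere on \<open>S\<close>. An unbounded operator is represented by its graph, a
  set of pairs \<open>(y, w)\<close> with \<open>y\<close> in the domain and \<open>w\<close> any representative of the image of \<open>y\<close>.\<close>

type_synonym vfun = "real \<Rightarrow> complex^2"

definition L2 :: "real set \<Rightarrow> vfun set" where
  "L2 S = {y. y \<in> borel_measurable (lebesgue_on S) \<and>
              integrable (lebesgue_on S) (\<lambda>x. (norm (y x))\<^sup>2)}"

definition L2_norm :: "real set \<Rightarrow> vfun \<Rightarrow> real" where
  "L2_norm S y = sqrt (integral\<^sup>L (lebesgue_on S) (\<lambda>x. (norm (y x))\<^sup>2))"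

definition null_fun :: "real set \<Rightarrow> vfun \<Rightarrow> bool" where
  "null_fun S y \<longleftrightarrow> (AE x in lebesgue_on S. y x = 0)"

definition shifted :: "complex \<Rightarrow> vfun \<Rightarrow> vfun \<Rightarrow> vfun" where
  "shifted lam y w = (\<lambda>x. w x - lam *s y x)"

text \<open>\<open>lam\<close> is in the resolvent set iff the operator minus \<open>lam\<close> is injective and surjective with
  bounded inverse.\<close>

definition resolvent_set :: "real set \<Rightarrow> (vfun \<times> vfun) set \<Rightarrow> complex set" where
  "resolvent_set S G = {lam.
     (\<forall>(y, w) \<in> G. null_fun S (shifted lam y w) \<longrightarrow> null_fun S y) \<and>
     (\<forall>z \<in> L2 S. \<exists>(y, w) \<in> G. AE x in lebesgue_on S. shifted lam y w x = z x) \<and>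
     (\<exists>C. \<forall>(y, w) \<in> G. L2_norm S y \<le> C * L2_norm S (shifted lam y w))}"

definition op_spectrum :: "real set \<Rightarrow> (vfun \<times> vfun) set \<Rightarrow> complex set" where
  "op_spectrum S G = - resolvent_set S G"

definition eigenvalue :: "real set \<Rightarrow> (vfun \<times> vfun) set \<Rightarrow> complex \<Rightarrow> bool" where
  "eigenvalue S G lam \<longleftrightarrow> (\<exists>(y, w) \<in> G. \<not> null_fun S y \<and> null_fun S (shifted lam y w))"

text \<open>\<open>root_vector S G lam n y\<close>: the \<open>n\<close>-th power of the operator minus \<open>lam\<close> annihilates \<open>y\<close>.\<close>

fun root_vector :: "real set \<Rightarrow> (vfun \<times> vfun) set \<Rightarrow> complex \<Rightarrow> nat \<Rightarrow> vfun \<Rightarrow> bool" where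
  "root_vector S G lam 0 y = null_fun S y"
| "root_vector S G lam (Suc n) y = (\<exists>w. (y, w) \<in> G \<and> root_vector S G lam n (shifted lam y w))"

text \<open>An eigenvalue of (algebraic) multiplicity one: an eigenvalue whose root space, the union of
  the kernels of all powers of the operator minus \<open>lam\<close>, is one-dimensional.\<close>

definition simple_eigenvalue :: "real set \<Rightarrow> (vfun \<times> vfun) set \<Rightarrow> complex \<Rightarrow> bool" where
  "simple_eigenvalue S G lam \<longleftrightarrow> eigenvalue S G lam \<and>
     (\<exists>y0. \<forall>n y. root_vector S G lam n y \<longrightarrow> (\<exists>c. null_fun S (\<lambda>x. y x - c *s y0 x)))"

definition unique_eigenvalue_in :: "real set \<Rightarrow> (vfun \<times> vfun) set \<Rightarrow> complex set \<Rightarrow> bool" where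
  "unique_eigenvalue_in S G B \<longleftrightarrow>
     (\<exists>lam \<in> B. simple_eigenvalue S G lam \<and> (\<forall>lam' \<in> B. eigenvalue S G lam' \<longrightarrow> lam' = lam))"


section \<open>Dirac operators\<close>

text \<open>\<open>ac_deriv S y g\<close>: on the interval \<open>S\<close>, the function \<open>y\<close> is locally absolutely continuous
  and \<open>g\<close> is its almost everywhere derivative, i.e. \<open>y\<close> is an indefinite integral of the locally
  integrable function \<open>g\<close>.\<close>

definition ac_deriv ::
  "real set \<Rightarrow> (real \<Rightarrow> 'a::euclidean_space) \<Rightarrow> (real \<Rightarrow> 'a) \<Rightarrow> bool" where
  "ac_deriv S y g \<longleftrightarrow> (\<forall>a b. a \<le> b \<and> {a..b} \<subseteq> S \<longrightarrow>
      g absolutely_integrable_on {a..b} \<and> y b - y a = integral {a..b} g)"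

definition dirac_J :: "complex^2^2" where
  "dirac_J = mat2 (- \<i>) 0 0 \<i>"

text \<open>The maximal operator of the Dirac expression on the interval \<open>S\<close>.\<close>

definition dirac_max :: "real set \<Rightarrow> (real \<Rightarrow> complex^2^2) \<Rightarrow> (vfun \<times> vfun) set" where
  "dirac_max S Q = {(y, w). y \<in> L2 S \<and> w \<in> L2 S \<and>
     (\<exists>g. ac_deriv S y g \<and> (AE x in lebesgue_on S. w x = dirac_J *v g x + Q x *v y x))}"

definition dirac_line :: "(real \<Rightarrow> complex^2^2) \<Rightarrow> (vfun \<times> vfun) set" where
  "dirac_line Q = dirac_max UNIV Q"

definition dirac_t :: "(real \<Rightarrow> complex^2^2) \<Rightarrow> real \<Rightarrow> (vfun \<times> vfun) set" where
  "dirac_t Q t = {(y, w) \<in> dirac_max {0..pi} Q.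
     y pi = exp (\<i> * of_real pi * of_real t) *s y 0}"

abbreviation spectrum_L :: "(real \<Rightarrow> complex^2^2) \<Rightarrow> complex set" where
  "spectrum_L Q \<equiv> op_spectrum UNIV (dirac_line Q)"


section \<open>The characteristic determinant and the function \<open>f\<close>\<close>

definition is_fundamental_matrix ::
  "(real \<Rightarrow> complex^2^2) \<Rightarrow> complex \<Rightarrow> (real \<Rightarrow> complex^2^2) \<Rightarrow> bool" where
  "is_fundamental_matrix Q lam E \<longleftrightarrow> E 0 = mat 1 \<and>
     (\<exists>G. ac_deriv UNIV E G \<and>
        (AE x in lebesgue. dirac_J ** G x + Q x ** E x = mat lam ** E x))"

definition fundamental_matrix ::
  "(real \<Rightarrow> complex^2^2) \<Rightarrow> complex \<Rightarrow> real \<Rightarrow> complex^2^2" where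
  "fundamental_matrix Q lam = (THE E. is_fundamental_matrix Q lam E)"

definition char_det :: "(real \<Rightarrow> complex^2^2) \<Rightarrow> complex \<Rightarrow> real \<Rightarrow> complex" where
  "char_det Q lam t = det (fundamental_matrix Q lam pi - mat (exp (\<i> * of_real pi * of_real t)))"

text \<open>\<open>char_rem\<close> is the function \<open>f\<close> determined by
  \<open>\<Delta>(lam,t) = -2 e\<^sup>i\<^sup>\<pi>\<^sup>t (cos (\<pi> lam) - cos (\<pi> t) + e\<^sup>-\<^sup>i\<^sup>\<pi>\<^sup>t f(lam))\<close>, where
  \<open>2 e\<^sup>i\<^sup>\<pi>\<^sup>t cos (\<pi> t) = e\<^sup>2\<^sup>i\<^sup>\<pi>\<^sup>t + 1\<close>. It depends on \<open>t\<close> only through the unimodular factor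
  \<open>e\<^sup>i\<^sup>\<pi>\<^sup>t\<close>, since for off-diagonal \<open>Q\<close> the fundamental matrix has determinant \<open>1\<close>; so a bound on
  its modulus is the same condition for every \<open>t\<close>.\<close>

definition char_rem :: "(real \<Rightarrow> complex^2^2) \<Rightarrow> real \<Rightarrow> complex \<Rightarrow> complex" where
  "char_rem Q t lam =
     (exp (2 * \<i> * of_real pi * of_real t)
       - 2 * exp (\<i> * of_real pi * of_real t) * cos (of_real pi * lam) + 1 - char_det Q lam t) / 2"


section \<open>The sequences and the constant \<open>N\<close>\<close>

definition estimate_at ::
  "(real \<Rightarrow> complex^2^2) \<Rightarrow> (int \<Rightarrow> real) \<Rightarrow> (int \<Rightarrow> real) \<Rightarrow> int \<Rightarrow> bool" where
  "estimate_at Q \<epsilon> \<delta> k \<longleftrightarrow> 9 / 2 * (\<epsilon> k)\<^sup>2 > \<delta> k \<and>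
     (\<forall>t \<in> {0..<2}. \<forall>lam. Re lam \<in> {2 * of_int k .. 2 * of_int k + 2} \<and> \<bar>Im lam\<bar> \<le> \<epsilon> k
        \<longrightarrow> norm (char_rem Q t lam) < \<delta> k)"

definition admissible_seqs ::
  "(real \<Rightarrow> complex^2^2) \<Rightarrow> (int \<Rightarrow> real) \<Rightarrow> (int \<Rightarrow> real) \<Rightarrow> bool" where
  "admissible_seqs Q \<epsilon> \<delta> \<longleftrightarrow>
     (\<forall>k. \<epsilon> k > 0) \<and> (\<forall>k. \<delta> k > 0) \<and>
     (\<epsilon> \<longlongrightarrow> 0) (filtercomap abs at_top) \<and> (\<delta> \<longlongrightarrow> 0) (filtercomap abs at_top) \<and>
     (\<forall>\<^sub>F k in filtercomap abs at_top. estimate_at Q \<epsilon> \<delta> k)"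

definition T_set :: "(int \<Rightarrow> real) \<Rightarrow> int \<Rightarrow> real set" where
  "T_set \<epsilon> k = {\<epsilon> k .. 1 - \<epsilon> k} \<union> {1 + \<epsilon> k .. 2 - \<epsilon> k}"

text \<open>Besides isolating the eigenvalues, \<open>N\<close> has to lie beyond the threshold hidden in the phrase
  ``for all sufficiently large \<open>|k|\<close>''. There the estimates hold and \<open>\<epsilon> k\<close> is small enough for the
  constant \<open>9/2\<close> to do its work: \<open>sin (\<pi> \<epsilon> / 2) \<ge> 3 \<epsilon> / 2\<close>, i.e.
  \<open>1 - cos (\<pi> \<epsilon>) \<ge> 9/2 \<epsilon>\<^sup>2\<close>, for \<open>\<epsilon> > 0\<close> holds exactly if \<open>\<epsilon> \<le> 1/3\<close>. Without this the
  bare isolation property would not force the intervals to consist of spectral points.\<close>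

definition admissible_const ::
  "(real \<Rightarrow> complex^2^2) \<Rightarrow> (int \<Rightarrow> real) \<Rightarrow> (int \<Rightarrow> real) \<Rightarrow> real \<Rightarrow> bool" where
  "admissible_const Q \<epsilon> \<delta> N \<longleftrightarrow> N > 0 \<and>
     (\<forall>k. of_int \<bar>k\<bar> > N \<longrightarrow> estimate_at Q \<epsilon> \<delta> k \<and> \<epsilon> k \<le> 1 / 3) \<and>
     (\<forall>k. of_int \<bar>k\<bar> > N \<longrightarrow> (\<forall>t \<in> T_set \<epsilon> k.
        unique_eigenvalue_in {0..pi} (dirac_t Q t) (ball (2 * of_int k + of_real t) (\<epsilon> k)) \<and>
        unique_eigenvalue_in {0..pi} (dirac_t Q t) (ball (2 * of_int k - of_real t) (\<epsilon> k))))"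

end

theory Submission
  imports Defs "HOL-Probability.Sinc_Integral"
begin

text \<open>
  For real \<open>lam\<close> let \<open>M\<close> be the value at \<open>\<pi>\<close> of the fundamental matrix of the off-diagonal
  system. Three facts decide everything. The coefficient matrix of the system has trace zero, so
  \<open>det M = 1\<close> (\<open>liouville\<close>). The symmetry \<open>cnj (p (- x)) = p x\<close> makes complex conjugation
  followed by reflection act on the solutions; this identifies \<open>cnj M\<close> with the inverse of
  \<open>M\<close>, and since \<open>det M = 1\<close> it follows that the trace of \<open>M\<close> is real
  (\<open>monodromy_trace_real\<close>). Finally \<open>f(lam)\<close> is, for \<open>t = 0\<close>, half the trace minus
  \<open>cos (\<pi> lam)\<close> (\<open>char_rem_eq\<close>). Away from the integers by \<open>\<epsilon> k\<close> one has
  \<open>\<bar>cos (\<pi> lam)\<bar> \<le> 1 - 9/2 (\<epsilon> k)\<^sup>2\<close>, and \<open>\<bar>f(lam)\<bar> < \<delta> k < 9/2 (\<epsilon> k)\<^sup>2\<close>, so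
  the trace lies in \<open>[-2, 2]\<close>. A matrix of determinant one with such a trace has an eigenvalue
  \<open>\<rho>\<close> of modulus one, and an eigenvector of it is the initial value of a solution that is
  multiplied by \<open>\<rho>\<close> over each period and is therefore bounded.

  The gauge transformation with the diagonal matrix of entries \<open>exp (\<i> \<phi>)\<close>,
  \<open>exp (\<i> \<psi>)\<close> carries solutions for \<open>lam\<close> and the off-diagonal potential to solutions for
  \<open>lam + \<gamma>\<close> and the original one (\<open>gauge_transformation\<close>). Over a period both phases
  increase by the same number, by the choice of \<open>\<gamma>\<close>, and this number is real, again by the
  symmetry; so boundedness is preserved. A bounded
  nontrivial solution puts its parameter into the spectrum: multiplied by a slowly decaying
  function it becomes square-integrable, and the operator minus its parameter makes it arbitrarily
  small in relation to its norm (\<open>bounded_solution_in_spectrum\<close>). This gives the intervals.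

  The complement of the intervals in \<open>(-2s, 2s)\<close> is, up to a bounded set, covered by
  intervals of length \<open>2 \<eta>\<close> about the points \<open>j + \<gamma>\<close>, \<open>j\<close> an integer, for any given
  \<open>\<eta> > 0\<close>; this gives the density (\<open>full_density\<close>). For the measure to be meaningful the
  spectrum has to be measurable. It is closed, as is shown by a Neumann series for the
  resolvent (\<open>closed_op_spectrum\<close>).

  The coefficients are merely locally integrable. Hence the calculus of locally absolutely
  continuous functions and the existence and uniqueness theorem for linear systems with such
  coefficients are developed first.
\<close>

section \<open>Locally absolutely continuous functions\<close>

definition locally_integrable :: "(real \<Rightarrow> 'a::euclidean_space) \<Rightarrow> bool" where
  "locally_integrable g \<longleftrightarrow> (\<forall>a b. g absolutely_integrable_on {a..b})"

text \<open>The function \<open>integral_from_0\<close> for values in an arbitrary Euclidean space.\<close>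
definition oriented_integral :: "(real \<Rightarrow> 'a::euclidean_space) \<Rightarrow> real \<Rightarrow> 'a" where
  "oriented_integral g x = (if 0 \<le> x then integral {0..x} g else - integral {x..0} g)"

lemma ac_deriv_UNIV:
  "ac_deriv UNIV y g \<longleftrightarrow> locally_integrable g \<and> (\<forall>a b. a \<le> b \<longrightarrow> y b - y a = integral {a..b} g)"
proof -
  have "g absolutely_integrable_on {a..b}"
    if "\<forall>a b. a \<le> b \<longrightarrow> g absolutely_integrable_on {a..b}" for a b
    using that by (cases "a \<le> b") auto
  then show ?thesis
    unfolding ac_deriv_def locally_integrable_def by auto
qed

lemma locally_integrable_integrable: "locally_integrable g \<Longrightarrow> g integrable_on {a..b}"
  unfolding locally_integrable_def by (meson set_lebesgue_integral_eq_integral(1))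

lemma locally_integrable_norm: "locally_integrable g \<Longrightarrow> locally_integrable (\<lambda>x. norm (g x))"
  unfolding locally_integrable_def using absolutely_integrable_norm[unfolded o_def] by blast

lemma locally_integrable_add:
  "locally_integrable f \<Longrightarrow> locally_integrable g \<Longrightarrow> locally_integrable (\<lambda>x. f x + g x)"
  unfolding locally_integrable_def by auto

lemma locally_integrable_diff:
  "locally_integrable f \<Longrightarrow> locally_integrable g \<Longrightarrow> locally_integrable (\<lambda>x. f x - g x)"
  unfolding locally_integrable_def by auto

lemma locally_integrable_linear:
  "bounded_linear h \<Longrightarrow> locally_integrable f \<Longrightarrow> locally_integrable (\<lambda>x. h (f x))"
  unfolding locally_integrable_def
  using absolutely_integrable_linear[unfolded o_def] by blast

lemma locally_integrable_continuous: "continuous_on UNIV f \<Longrightarrow> locally_integrable f"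
  unfolding locally_integrable_def
  by (meson absolutely_integrable_continuous_real continuous_on_subset subset_UNIV)

lemma locally_integrable_bilinear:
  fixes h :: "'a::euclidean_space \<Rightarrow> 'b::euclidean_space \<Rightarrow> 'c::euclidean_space"
  assumes h: "bounded_bilinear h" and f: "continuous_on UNIV f" and g: "locally_integrable g"
  shows "locally_integrable (\<lambda>x. h (f x) (g x))"
  unfolding locally_integrable_def
proof (intro allI)
  fix a b :: real
  have c: "continuous_on {a..b} f"
    using f continuous_on_subset by blast
  show "(\<lambda>x. h (f x) (g x)) absolutely_integrable_on {a..b}"
  proof (rule absolutely_integrable_bounded_measurable_product[where h = h and f = f and g = g])
    show "bilinear h"
      using h by (simp add: bilinear_conv_bounded_bilinear)
  next
    show "f \<in> borel_measurable (lebesgue_on {a..b})"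
      using c by (simp add: continuous_imp_measurable_on_sets_lebesgue)
    show "bounded (f ` {a..b})"
      using c by (simp add: compact_continuous_image compact_imp_bounded)
  qed (use g in \<open>auto simp: locally_integrable_def\<close>)
qed

lemma locally_integrable_bilinear':
  fixes h :: "'a::euclidean_space \<Rightarrow> 'b::euclidean_space \<Rightarrow> 'c::euclidean_space"
  assumes "bounded_bilinear h" "locally_integrable f" "continuous_on UNIV g"
  shows "locally_integrable (\<lambda>x. h (f x) (g x))"
  using locally_integrable_bilinear[OF bounded_bilinear.flip[OF assms(1)] assms(3,2)] .

lemma locally_integrable_shift:
  assumes "locally_integrable f" shows "locally_integrable (\<lambda>x. f (x + c))"
  unfolding locally_integrable_def
proof (intro allI)
  fix a b
  have "f absolutely_integrable_on {a + c..b + c}"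
    using assms by (auto simp: locally_integrable_def)
  then show "(\<lambda>x. f (x + c)) absolutely_integrable_on {a..b}"
    using integrable_shift_real_ivl[of f "a + c" "b + c" c]
      integrable_shift_real_ivl[of "\<lambda>x. norm (f x)" "a + c" "b + c" c]
    by (simp add: absolutely_integrable_on_def)
qed

lemma locally_integrable_reflect:
  assumes "locally_integrable f" shows "locally_integrable (\<lambda>x. f (- x))"
  unfolding locally_integrable_def
proof (intro allI)
  fix a b
  have "f absolutely_integrable_on {-b..-a}"
    using assms by (auto simp: locally_integrable_def)
  then show "(\<lambda>x. f (- x)) absolutely_integrable_on {a..b}"
    using absolutely_integrable_reflect_real[where f = f and a = "-b" and b = "-a"] by simp
qed

lemma ac_deriv_oriented_integral:
  assumes "locally_integrable g"
  shows "ac_deriv UNIV (oriented_integral g) g"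
  unfolding ac_deriv_UNIV
proof (intro conjI allI impI assms)
  fix a b :: real assume "a \<le> b"
  note i = locally_integrable_integrable[OF assms]
  consider "0 \<le> a" | "a < 0" "0 \<le> b" | "b < 0" by linarith
  then show "oriented_integral g b - oriented_integral g a = integral {a..b} g"
  proof cases
    case 1 with \<open>a \<le> b\<close> show ?thesis
      using Henstock_Kurzweil_Integration.integral_combine[of 0 a b g] i by (simp add: oriented_integral_def algebra_simps)
  next
    case 2 then show ?thesis
      using Henstock_Kurzweil_Integration.integral_combine[of a 0 b g] i by (simp add: oriented_integral_def algebra_simps)
  next
    case 3 with \<open>a \<le> b\<close> show ?thesis
      using Henstock_Kurzweil_Integration.integral_combine[of a b 0 g] i by (simp add: oriented_integral_def algebra_simps)
  qed
qed

lemma oriented_integral_0 [simp]: "oriented_integral g 0 = 0"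
  by (simp add: oriented_integral_def)

lemma ac_deriv_eq_oriented_integral:
  assumes "ac_deriv UNIV y g" shows "y x = y 0 + oriented_integral g x"
  using assms unfolding ac_deriv_UNIV oriented_integral_def
  by (smt (verit, best) add.commute diff_add_cancel minus_diff_eq)

lemma norm_oriented_integral_le:
  fixes g :: "real \<Rightarrow> 'a::euclidean_space"
  assumes "locally_integrable g" "locally_integrable k"
    and "\<And>s. s \<in> closed_segment 0 x \<Longrightarrow> norm (g s) \<le> k s"
  shows "norm (oriented_integral g x) \<le> \<bar>oriented_integral k x\<bar>"
proof (cases "0 \<le> x")
  case True
  have "norm (integral {0..x} g) \<le> integral {0..x} k"
    using assms True by (intro integral_norm_bound_integral locally_integrable_integrable)
      (auto simp: closed_segment_eq_real_ivl)
  then show ?thesis using True by (simp add: oriented_integral_def)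
next
  case False
  have "norm (integral {x..0} g) \<le> integral {x..0} k"
    using assms False by (intro integral_norm_bound_integral locally_integrable_integrable)
      (auto simp: closed_segment_eq_real_ivl)
  then show ?thesis using False by (simp add: oriented_integral_def)
qed

lemma oriented_integral_diff:
  assumes "locally_integrable f" "locally_integrable g"
  shows "oriented_integral (\<lambda>x. f x - g x) x = oriented_integral f x - oriented_integral g x"
  using assms
  by (simp add: oriented_integral_def locally_integrable_integrable
      Henstock_Kurzweil_Integration.integral_diff)

lemma oriented_integral_cmult:
  fixes f :: "real \<Rightarrow> real"
  shows "oriented_integral (\<lambda>x. c * f x) x = c * oriented_integral f x"
  by (simp add: oriented_integral_def)

lemma ac_deriv_continuous:
  assumes "ac_deriv UNIV y g" shows "continuous_on UNIV y"
proof -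
  have "continuous (at x) y" for x
  proof -
    have "g integrable_on {x-1..x+1}"
      using assms locally_integrable_integrable ac_deriv_UNIV by blast
    then have "continuous_on {x-1..x+1} (\<lambda>z. y (x-1) + integral {x-1..z} g)"
      by (intro continuous_intros indefinite_integral_continuous_1)
    also have "?this \<longleftrightarrow> continuous_on {x-1..x+1} y"
    proof (rule continuous_on_cong[OF refl])
      fix z assume "z \<in> {x-1..x+1}"
      then have "y z - y (x-1) = integral {x-1..z} g"
        using assms by (simp add: ac_deriv_UNIV)
      then show "y (x-1) + integral {x-1..z} g = y z" by (simp add: algebra_simps)
    qed
    finally have "continuous_on {x-1<..<x+1} y"
      by (rule continuous_on_subset) auto
    then show ?thesis
      by (simp add: continuous_on_eq_continuous_at)
  qed
  then show ?thesis
    by (simp add: continuous_on_eq_continuous_at)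
qed

lemma ac_deriv_linear:
  assumes h: "bounded_linear h" and y: "ac_deriv UNIV y g"
  shows "ac_deriv UNIV (\<lambda>x. h (y x)) (\<lambda>x. h (g x))"
  unfolding ac_deriv_UNIV
proof (intro conjI allI impI)
  show "locally_integrable (\<lambda>x. h (g x))"
    using assms ac_deriv_UNIV locally_integrable_linear by blast
  fix a b :: real assume "a \<le> b"
  then have "integral {a..b} (\<lambda>x. h (g x)) = h (integral {a..b} g)"
    using integral_linear[OF _ h, of g "{a..b}"] y locally_integrable_integrable
    by (auto simp: ac_deriv_UNIV o_def)
  also have "\<dots> = h (y b) - h (y a)"
    using y \<open>a \<le> b\<close> h by (metis ac_deriv_UNIV linear_diff[OF bounded_linear.linear[OF h]])
  finally show "h (y b) - h (y a) = integral {a..b} (\<lambda>x. h (g x))" ..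
qed

lemma ac_deriv_diff:
  assumes "ac_deriv UNIV y g" "ac_deriv UNIV z h"
  shows "ac_deriv UNIV (\<lambda>x. y x - z x) (\<lambda>x. g x - h x)"
  unfolding ac_deriv_UNIV
proof (intro conjI allI impI)
  show "locally_integrable (\<lambda>x. g x - h x)"
    using assms ac_deriv_UNIV locally_integrable_diff by blast
  fix a b :: real assume "a \<le> b"
  then have "integral {a..b} (\<lambda>x. g x - h x) = integral {a..b} g - integral {a..b} h"
    using assms by (intro Henstock_Kurzweil_Integration.integral_diff) (auto simp: ac_deriv_UNIV locally_integrable_integrable)
  also have "\<dots> = (y b - y a) - (z b - z a)"
    using assms \<open>a \<le> b\<close> by (simp add: ac_deriv_UNIV)
  finally show "y b - z b - (y a - z a) = integral {a..b} (\<lambda>x. g x - h x)"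
    by (simp add: algebra_simps)
qed

lemma ac_deriv_add:
  assumes "ac_deriv UNIV y g" "ac_deriv UNIV z h"
  shows "ac_deriv UNIV (\<lambda>x. y x + z x) (\<lambda>x. g x + h x)"
proof -
  have "ac_deriv UNIV (\<lambda>x. - z x) (\<lambda>x. - h x)"
    by (rule ac_deriv_linear[OF _ assms(2)]) (simp add: bounded_linear_minus)
  from ac_deriv_diff[OF assms(1) this] show ?thesis by simp
qed

lemma ac_deriv_shift:
  assumes "ac_deriv UNIV y g"
  shows "ac_deriv UNIV (\<lambda>x. y (x + c)) (\<lambda>x. g (x + c))"
  unfolding ac_deriv_UNIV
proof (intro conjI allI impI)
  show "locally_integrable (\<lambda>x. g (x + c))"
    using assms ac_deriv_UNIV locally_integrable_shift by blast
  fix a b :: real assume "a \<le> b"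
  then show "y (b + c) - y (a + c) = integral {a..b} (\<lambda>x. g (x + c))"
    using assms integral_shift_real_ivl[of "a + c" c "b + c" g] by (simp add: ac_deriv_UNIV)
qed

lemma ac_deriv_reflect:
  assumes "ac_deriv UNIV y g"
  shows "ac_deriv UNIV (\<lambda>x. y (- x)) (\<lambda>x. - g (- x))"
  unfolding ac_deriv_UNIV
proof (intro conjI allI impI)
  show "locally_integrable (\<lambda>x. - g (- x))"
    using assms ac_deriv_UNIV locally_integrable_reflect
      locally_integrable_linear[OF bounded_linear_minus[OF bounded_linear_ident]] by blast
  fix a b :: real assume "a \<le> b"
  then show "y (-b) - y (-a) = integral {a..b} (\<lambda>x. - g (- x))"
    using assms Henstock_Kurzweil_Integration.integral_reflect_real[of "-a" "-b" g]
    by (simp add: ac_deriv_UNIV) (metis minus_diff_eq neg_le_iff_le)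
qed

lemma ac_deriv_cong_ae:
  assumes "ac_deriv UNIV y g" and ae: "AE x in lebesgue. h x = g x"
  shows "ac_deriv UNIV y h"
proof -
  obtain N where N: "negligible N" "\<And>x. x \<notin> N \<Longrightarrow> h x = g x"
    using ae unfolding eventually_ae_filter negligible_iff_null_sets by auto
  have "integral {a..b} h = integral {a..b} g" for a b
    by (rule integral_spike[OF N(1)]) (use N(2) in auto)
  moreover have "h absolutely_integrable_on {a..b}" if "g absolutely_integrable_on {a..b}" for a b
    by (rule absolutely_integrable_spike[OF that N(1)]) (use N(2) in auto)
  ultimately show ?thesis
    using assms(1) unfolding ac_deriv_UNIV locally_integrable_def by metis
qed

lemma ac_deriv_of_has_vector_derivative:
  assumes "\<And>x. (y has_vector_derivative g x) (at x)" "continuous_on UNIV g"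
  shows "ac_deriv UNIV y g"
  unfolding ac_deriv_UNIV
proof (intro conjI allI impI)
  show "locally_integrable g" using assms(2) by (rule locally_integrable_continuous)
  fix a b :: real assume "a \<le> b"
  then have "(g has_integral y b - y a) {a..b}"
    by (rule fundamental_theorem_of_calculus) (rule has_vector_derivative_at_within[OF assms(1)])
  then show "y b - y a = integral {a..b} g" by (simp add: integral_unique)
qed

text \<open>A substitute for \<open>a function with derivative zero is constant\<close> that needs no
  derivative: cutting \<open>[a, b]\<close> into short pieces and adding up, the increment of \<open>H\<close> is at most
  \<open>e (m b - m a)\<close> for every \<open>e > 0\<close>. The product rule and the chain rule for \<open>exp\<close> below
  follow from it, although absolutely continuous functions are differentiable almost everywhere
  only.\<close>
lemma eq_if_increments_dominated:
  fixes H :: "real \<Rightarrow> 'a::real_normed_vector" and m :: "real \<Rightarrow> real"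
  assumes "a \<le> b"
    and small: "\<And>e. e > 0 \<Longrightarrow> \<exists>d>0. \<forall>u v. a \<le> u \<and> u \<le> v \<and> v \<le> b \<and> v - u < d \<longrightarrow>
      norm (H v - H u) \<le> e * (m v - m u)"
  shows "H b = H a"
proof -
  have le: "norm (H b - H a) \<le> e * (m b - m a)" if "e > 0" for e
  proof -
    obtain d where d: "d > 0" and D: "\<And>u v. a \<le> u \<Longrightarrow> u \<le> v \<Longrightarrow> v \<le> b \<Longrightarrow> v - u < d \<Longrightarrow>
      norm (H v - H u) \<le> e * (m v - m u)"
      using small[OF \<open>e > 0\<close>] by metis
    obtain n :: nat where n: "(b - a) / d < real n" "n > 0"
      using reals_Archimedean2[of "max ((b - a) / d) 0"] by auto
    define u where "u i = a + real i * (b - a) / real n" for i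
    have u0: "u 0 = a" and un: "u n = b" using n by (auto simp: u_def)
    have step: "u (Suc i) - u i = (b - a) / real n" for i
      by (simp add: u_def algebra_simps flip: add_divide_distrib diff_divide_distrib)
    have "(b - a) / real n < d" using n d by (simp add: field_simps)
    moreover have "(b - a) / real n \<ge> 0" using \<open>a \<le> b\<close> by simp
    ultimately have step': "u (Suc i) - u i < d" "u i \<le> u (Suc i)" for i
      using step[of i] by linarith+
    have mono: "i \<le> j \<Longrightarrow> u i \<le> u j" for i j
      using step'(2) by (rule lift_Suc_mono_le)
    have "norm (H b - H a) = norm (\<Sum>i<n. H (u (Suc i)) - H (u i))"
      using u0 un sum_lessThan_telescope[of "\<lambda>i. H (u i)" n] by simp
    also have "\<dots> \<le> (\<Sum>i<n. norm (H (u (Suc i)) - H (u i)))"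
      by (rule norm_sum)
    also have "\<dots> \<le> (\<Sum>i<n. e * (m (u (Suc i)) - m (u i)))"
    proof (rule sum_mono)
      fix i assume "i \<in> {..<n}"
      then show "norm (H (u (Suc i)) - H (u i)) \<le> e * (m (u (Suc i)) - m (u i))"
        using mono[of 0 i] mono[of "Suc i" n] step'[of i] u0 un by (intro D) auto
    qed
    also have "\<dots> = e * (m b - m a)"
      using u0 un sum_lessThan_telescope[of "\<lambda>i. m (u i)" n] by (simp flip: sum_distrib_left)
    finally show ?thesis .
  qed
  have "norm (H b - H a) \<le> e" if "e > 0" for e
  proof -
    have "norm (H b - H a) \<le> (e / (\<bar>m b - m a\<bar> + 1)) * (m b - m a)"
      using that by (intro le) auto
    also have "\<dots> \<le> e * ((\<bar>m b - m a\<bar>) / (\<bar>m b - m a\<bar> + 1))"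
      using that by (simp add: divide_right_mono mult_left_mono)
    also have "\<dots> \<le> e * 1"
      using that by (intro mult_left_mono) auto
    finally show ?thesis by simp
  qed
  then have "norm (H b - H a) \<le> 0" by (rule field_le_epsilon) auto
  then show ?thesis by simp
qed

text \<open>An error that is small in relation to \<open>\<integral>k\<close> on short intervals, for a fixed locally
  integrable \<open>k\<close>, adds up to zero, by the preceding lemma applied to the difference of
  \<open>y\<close> and the indefinite integral of \<open>g\<close>.\<close>
lemma ac_derivI_dominated:
  fixes y g :: "real \<Rightarrow> 'a::euclidean_space" and k :: "real \<Rightarrow> real"
  assumes g: "locally_integrable g" and k: "locally_integrable k"
    and small: "\<And>a b e. a \<le> b \<Longrightarrow> e > 0 \<Longrightarrow> \<exists>d>0. \<forall>u v. a \<le> u \<and> u \<le> v \<and> v \<le> b \<and> v - u < d \<longrightarrow>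
      norm (y v - y u - integral {u..v} g) \<le> e * integral {u..v} k"
  shows "ac_deriv UNIV y g"
  unfolding ac_deriv_UNIV
proof (intro conjI allI impI g)
  fix a b :: real assume "a \<le> b"
  have G: "oriented_integral g v - oriented_integral g u = integral {u..v} g" if "u \<le> v" for u v
    using ac_deriv_oriented_integral[OF g] that by (simp add: ac_deriv_UNIV)
  have K: "oriented_integral k v - oriented_integral k u = integral {u..v} k" if "u \<le> v" for u v
    using ac_deriv_oriented_integral[OF k] that by (simp add: ac_deriv_UNIV)
  have "y b - oriented_integral g b = y a - oriented_integral g a"
  proof (rule eq_if_increments_dominated[where m = "oriented_integral k", OF \<open>a \<le> b\<close>])
    fix e :: real assume "e > 0"
    obtain d where d: "d > 0" and D: "\<forall>u v. a \<le> u \<and> u \<le> v \<and> v \<le> b \<and> v - u < d \<longrightarrow>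
      norm (y v - y u - integral {u..v} g) \<le> e * integral {u..v} k"
      using small[OF \<open>a \<le> b\<close> \<open>e > 0\<close>] by blast
    have "norm (y v - oriented_integral g v - (y u - oriented_integral g u))
            \<le> e * (oriented_integral k v - oriented_integral k u)"
      if "a \<le> u" "u \<le> v" "v \<le> b" "v - u < d" for u v
    proof -
      have "y v - oriented_integral g v - (y u - oriented_integral g u)
              = y v - y u - integral {u..v} g"
        by (simp add: G[OF \<open>u \<le> v\<close>, symmetric] algebra_simps)
      then show ?thesis using D that K[OF \<open>u \<le> v\<close>] by presburger
    qed
    with d show "\<exists>d>0. \<forall>u v. a \<le> u \<and> u \<le> v \<and> v \<le> b \<and> v - u < d \<longrightarrow>
        norm (y v - oriented_integral g v - (y u - oriented_integral g u))
            \<le> e * (oriented_integral k v - oriented_integral k u)" by blast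
  qed
  then show "y b - y a = integral {a..b} g"
    using G[OF \<open>a \<le> b\<close>] by (simp add: algebra_simps)
qed

section \<open>Differential equations of Caratheodory type\<close>

lemma uniform_continuity_Icc:
  fixes f :: "real \<Rightarrow> 'a::metric_space"
  assumes "continuous_on UNIV f" "e > 0"
  obtains d where "d > 0"
    "\<And>x y. x \<in> {a..b} \<Longrightarrow> y \<in> {a..b} \<Longrightarrow> \<bar>x - y\<bar> < d \<Longrightarrow> dist (f x) (f y) < e"
proof -
  have "uniformly_continuous_on {a..b} f"
    using assms(1) by (intro compact_uniformly_continuous) (auto intro: continuous_on_subset)
  then show ?thesis
    using that assms(2) unfolding uniformly_continuous_on_def dist_real_def by metis
qed

text \<open>The product rule. On a short interval \<open>[u, v]\<close> the increment of \<open>h (f x) (g x)\<close> is the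
  integral of \<open>h (f' x) (g v) + h (f u) (g' x)\<close>, and replacing \<open>g v\<close> and \<open>f u\<close> by
  \<open>g x\<close> and \<open>f x\<close> costs little, by uniform continuity.\<close>
lemma ac_deriv_bilinear:
  fixes h :: "'a::euclidean_space \<Rightarrow> 'b::euclidean_space \<Rightarrow> 'c::euclidean_space"
  assumes h: "bounded_bilinear h" and f: "ac_deriv UNIV f f'" and g: "ac_deriv UNIV g g'"
  shows "ac_deriv UNIV (\<lambda>x. h (f x) (g x)) (\<lambda>x. h (f' x) (g x) + h (f x) (g' x))"
proof (rule ac_derivI_dominated[where k = "\<lambda>x. norm (f' x) + norm (g' x)"])
  interpret h: bounded_bilinear h by (rule h)
  have cf: "continuous_on UNIV f" and cg: "continuous_on UNIV g"
    using f g ac_deriv_continuous by auto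
  have lf: "locally_integrable f'" and lg: "locally_integrable g'"
    using f g ac_deriv_UNIV by auto
  have l1: "locally_integrable (\<lambda>x. h (f' x) (g x))" and l2: "locally_integrable (\<lambda>x. h (f x) (g' x))"
    using locally_integrable_bilinear[OF h cf lg] locally_integrable_bilinear'[OF h lf cg] by auto
  show l12: "locally_integrable (\<lambda>x. h (f' x) (g x) + h (f x) (g' x))"
    using l1 l2 locally_integrable_add by blast
  show lk: "locally_integrable (\<lambda>x. norm (f' x) + norm (g' x))"
    by (intro locally_integrable_add locally_integrable_norm lf lg)
  fix a b e :: real assume "a \<le> b" "e > 0"
  obtain C where C: "C > 0" "\<And>x y. norm (h x y) \<le> norm x * norm y * C"
    using h.pos_bounded by blast
  obtain d1 where d1: "d1 > 0" "\<And>x y. x \<in> {a..b} \<Longrightarrow> y \<in> {a..b} \<Longrightarrow> \<bar>x - y\<bar> < d1 \<Longrightarrow>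
      dist (f x) (f y) < e / C"
    using uniform_continuity_Icc[OF cf, of "e / C"] \<open>e > 0\<close> C(1) by (metis divide_pos_pos)
  obtain d2 where d2: "d2 > 0" "\<And>x y. x \<in> {a..b} \<Longrightarrow> y \<in> {a..b} \<Longrightarrow> \<bar>x - y\<bar> < d2 \<Longrightarrow>
      dist (g x) (g y) < e / C"
    using uniform_continuity_Icc[OF cg, of "e / C"] \<open>e > 0\<close> C(1) by (metis divide_pos_pos)
  have "norm (h (f v) (g v) - h (f u) (g u) - integral {u..v} (\<lambda>x. h (f' x) (g x) + h (f x) (g' x)))
      \<le> e * integral {u..v} (\<lambda>x. norm (f' x) + norm (g' x))"
    if uv: "a \<le> u" "u \<le> v" "v \<le> b" "v - u < min d1 d2" for u v
  proof -
    have "ac_deriv UNIV (\<lambda>x. h (f x) (g v)) (\<lambda>x. h (f' x) (g v))"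
      by (rule ac_deriv_linear[OF h.bounded_linear_left f])
    moreover have "ac_deriv UNIV (\<lambda>x. h (f u) (g x)) (\<lambda>x. h (f u) (g' x))"
      by (rule ac_deriv_linear[OF h.bounded_linear_right g])
    ultimately have ac: "ac_deriv UNIV (\<lambda>x. h (f x) (g v) + h (f u) (g x)) (\<lambda>x. h (f' x) (g v) + h (f u) (g' x))"
      by (rule ac_deriv_add)
    have li: "locally_integrable (\<lambda>x. h (f' x) (g v) + h (f u) (g' x))"
      using ac ac_deriv_UNIV by blast
    have "h (f v) (g v) - h (f u) (g u)
        = (h (f v) (g v) + h (f u) (g v)) - (h (f u) (g v) + h (f u) (g u))"
      by simp
    also have "\<dots> = integral {u..v} (\<lambda>x. h (f' x) (g v) + h (f u) (g' x))"
      using ac uv(2) by (simp add: ac_deriv_UNIV)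
    finally have "h (f v) (g v) - h (f u) (g u) - integral {u..v} (\<lambda>x. h (f' x) (g x) + h (f x) (g' x))
      = integral {u..v} (\<lambda>x. h (f' x) (g v) + h (f u) (g' x) - (h (f' x) (g x) + h (f x) (g' x)))"
      by (simp add: Henstock_Kurzweil_Integration.integral_diff locally_integrable_integrable li l12)
    also have "norm \<dots> \<le> integral {u..v} (\<lambda>x. e * (norm (f' x) + norm (g' x)))"
    proof (rule integral_norm_bound_integral)
      show "(\<lambda>x. h (f' x) (g v) + h (f u) (g' x) - (h (f' x) (g x) + h (f x) (g' x))) integrable_on {u..v}"
        by (intro locally_integrable_integrable locally_integrable_diff li l12)
      show "(\<lambda>x. e * (norm (f' x) + norm (g' x))) integrable_on {u..v}"
        by (intro integrable_on_mult_right locally_integrable_integrable lk)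
      fix x assume x: "x \<in> {u..v}"
      have "norm (h (f' x) (g v - g x)) \<le> norm (f' x) * (e / C) * C"
        using C(1) d2(2)[of v x] x uv
        by (intro order_trans[OF C(2)] mult_right_mono mult_left_mono) (auto simp: dist_norm)
      moreover have "norm (h (f u - f x) (g' x)) \<le> (e / C) * norm (g' x) * C"
        using C(1) d1(2)[of u x] x uv
        by (intro order_trans[OF C(2)] mult_right_mono) (auto simp: dist_norm)
      ultimately have "norm (h (f' x) (g v - g x)) + norm (h (f u - f x) (g' x)) \<le> e * (norm (f' x) + norm (g' x))"
        using C(1) by (simp add: field_simps)
      moreover have "h (f' x) (g v) + h (f u) (g' x) - (h (f' x) (g x) + h (f x) (g' x))
          = h (f' x) (g v - g x) + h (f u - f x) (g' x)"
        by (simp add: h.diff_left h.diff_right)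
      ultimately show "norm (h (f' x) (g v) + h (f u) (g' x) - (h (f' x) (g x) + h (f x) (g' x)))
          \<le> e * (norm (f' x) + norm (g' x))"
        by (metis norm_triangle_ineq order_trans)
    qed
    finally show ?thesis by simp
  qed
  then show "\<exists>d>0. \<forall>u v. a \<le> u \<and> u \<le> v \<and> v \<le> b \<and> v - u < d \<longrightarrow>
     norm (h (f v) (g v) - h (f u) (g u) - integral {u..v} (\<lambda>x. h (f' x) (g x) + h (f x) (g' x)))
      \<le> e * integral {u..v} (\<lambda>x. norm (f' x) + norm (g' x))"
    using d1(1) d2(1) by (intro exI[of _ "min d1 d2"]) auto
qed

lemma exp_remainder_small:
  assumes "e > 0"
  shows "\<exists>d>0. \<forall>z::'a::{real_normed_field,banach}. norm z < d \<longrightarrow> norm (exp z - 1 - z) \<le> e * norm z"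
proof -
  have "((exp :: 'a \<Rightarrow> 'a) has_derivative (*) 1) (at 0)"
    using DERIV_exp[of "0::'a"] by (simp add: has_field_derivative_def)
  then have "\<exists>d>0. \<forall>z::'a. norm (z - 0) < d \<longrightarrow> norm (exp z - exp 0 - 1 * (z - 0)) \<le> e * norm (z - 0)"
    using assms unfolding has_derivative_at_alt by blast
  then show ?thesis by (simp only: exp_zero diff_zero mult_1)
qed

text \<open>The chain rule for \<open>exp\<close>. With \<open>D = f v - f u\<close> the increment of \<open>exp \<circ> f\<close> is
  \<open>exp (f u) (exp D - 1)\<close>. The remainder \<open>exp D - 1 - D\<close> is small in relation to
  \<open>norm D\<close>, which is at most the integral of \<open>norm f'\<close>.\<close>
lemma ac_deriv_exp:
  fixes f :: "real \<Rightarrow> 'a::{real_normed_field,banach,euclidean_space}"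
  assumes f: "ac_deriv UNIV f f'"
  shows "ac_deriv UNIV (\<lambda>x. exp (f x)) (\<lambda>x. f' x * exp (f x))"
proof (rule ac_derivI_dominated[where k = "\<lambda>x. norm (f' x)"])
  have cf: "continuous_on UNIV f" and lf: "locally_integrable f'"
    using f ac_deriv_continuous ac_deriv_UNIV by auto
  then have ce: "continuous_on UNIV (\<lambda>x. exp (f x))"
    by (intro continuous_intros)
  show l: "locally_integrable (\<lambda>x. f' x * exp (f x))"
    by (rule locally_integrable_bilinear'[OF bounded_bilinear_mult lf ce])
  show lk: "locally_integrable (\<lambda>x. norm (f' x))"
    by (intro locally_integrable_norm lf)
  fix a b e :: real assume "a \<le> b" "e > 0"
  have "bounded ((\<lambda>x. exp (f x)) ` {a..b})"
    using ce by (meson compact_Icc compact_continuous_image compact_imp_bounded continuous_on_subset subset_UNIV)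
  then obtain B where B: "B > 0" "\<And>x. x \<in> {a..b} \<Longrightarrow> norm (exp (f x)) \<le> B"
    by (auto simp: bounded_pos)
  have "e / (2 * B) > 0" using \<open>e > 0\<close> B(1) by simp
  then obtain d0 where d0: "d0 > 0" "\<And>z::'a. norm z < d0 \<Longrightarrow> norm (exp z - 1 - z) \<le> e / (2 * B) * norm z"
    using exp_remainder_small[where 'a = 'a] by blast
  obtain d1 where d1: "d1 > 0" "\<And>x y. x \<in> {a..b} \<Longrightarrow> y \<in> {a..b} \<Longrightarrow> \<bar>x - y\<bar> < d1 \<Longrightarrow>
      dist (f x) (f y) < d0"
    using uniform_continuity_Icc[OF cf d0(1)] by metis
  obtain d2 where d2: "d2 > 0" "\<And>x y. x \<in> {a..b} \<Longrightarrow> y \<in> {a..b} \<Longrightarrow> \<bar>x - y\<bar> < d2 \<Longrightarrow>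
      dist (exp (f x)) (exp (f y)) < e / 2"
    using uniform_continuity_Icc[OF ce, of "e / 2"] \<open>e > 0\<close> by (metis half_gt_zero)
  have "norm (exp (f v) - exp (f u) - integral {u..v} (\<lambda>x. f' x * exp (f x)))
      \<le> e * integral {u..v} (\<lambda>x. norm (f' x))"
    if uv: "a \<le> u" "u \<le> v" "v \<le> b" "v - u < min d1 d2" for u v
  proof -
    let ?I = "integral {u..v} (\<lambda>x. norm (f' x))"
    define D where "D = f v - f u"
    have D: "D = integral {u..v} f'"
      using f uv by (simp add: ac_deriv_UNIV D_def)
    have "norm D \<le> ?I"
      unfolding D by (intro integral_norm_bound_integral locally_integrable_integrable lf lk) auto
    have "norm D < d0"
      using d1(2)[of v u] uv by (simp add: dist_norm D_def)
    have "exp (f v) = exp (f u) * exp D"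
      by (simp add: D_def flip: exp_add)
    then have eq: "exp (f v) - exp (f u) - integral {u..v} (\<lambda>x. f' x * exp (f x))
        = exp (f u) * (exp D - 1 - D) + (D * exp (f u) - integral {u..v} (\<lambda>x. f' x * exp (f x)))"
      by (simp add: algebra_simps)
    have "norm (exp (f u) * (exp D - 1 - D)) \<le> B * (e / (2 * B) * norm D)"
      unfolding norm_mult using B uv by (intro mult_mono d0 \<open>norm D < d0\<close>) auto
    also have "\<dots> = e / 2 * norm D" using B(1) by simp
    also have "\<dots> \<le> e / 2 * ?I"
      using \<open>norm D \<le> ?I\<close> \<open>e > 0\<close> by (intro mult_left_mono) auto
    finally have 1: "norm (exp (f u) * (exp D - 1 - D)) \<le> e / 2 * ?I" .
    have lu: "locally_integrable (\<lambda>x. f' x * exp (f u))"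
      by (rule locally_integrable_linear[OF bounded_linear_mult_left lf])
    have "integral {u..v} (\<lambda>x. f' x * exp (f u)) = D * exp (f u)"
      using ac_deriv_linear[OF bounded_linear_mult_left f, of "exp (f u)"] uv
      by (simp add: ac_deriv_UNIV D_def left_diff_distrib)
    then have "D * exp (f u) - integral {u..v} (\<lambda>x. f' x * exp (f x))
        = integral {u..v} (\<lambda>x. f' x * exp (f u) - f' x * exp (f x))"
      using Henstock_Kurzweil_Integration.integral_diff[OF locally_integrable_integrable[OF lu]
          locally_integrable_integrable[OF l], of u v] by (simp only:)
    also have "norm \<dots> \<le> integral {u..v} (\<lambda>x. e / 2 * norm (f' x))"
    proof (rule integral_norm_bound_integral)
      show "(\<lambda>x. f' x * exp (f u) - f' x * exp (f x)) integrable_on {u..v}"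
        by (intro locally_integrable_integrable locally_integrable_diff lu l)
      show "(\<lambda>x. e / 2 * norm (f' x)) integrable_on {u..v}"
        by (intro integrable_on_mult_right locally_integrable_integrable lk)
      fix x assume x: "x \<in> {u..v}"
      have "norm (f' x * exp (f u) - f' x * exp (f x)) = norm (f' x) * dist (exp (f u)) (exp (f x))"
        by (simp add: dist_norm flip: norm_mult right_diff_distrib)
      also have "\<dots> \<le> norm (f' x) * (e / 2)"
        using d2(2)[of u x] x uv by (intro mult_left_mono) auto
      finally show "norm (f' x * exp (f u) - f' x * exp (f x)) \<le> e / 2 * norm (f' x)"
        by (simp add: mult.commute)
    qed
    finally have 2: "norm (D * exp (f u) - integral {u..v} (\<lambda>x. f' x * exp (f x))) \<le> e / 2 * ?I"
      by simp
    show ?thesis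
      unfolding eq using norm_triangle_le[OF add_mono[OF 1 2]] by simp
  qed
  then show "\<exists>d>0. \<forall>u v. a \<le> u \<and> u \<le> v \<and> v \<le> b \<and> v - u < d \<longrightarrow>
     norm (exp (f v) - exp (f u) - integral {u..v} (\<lambda>x. f' x * exp (f x)))
      \<le> e * integral {u..v} (\<lambda>x. norm (f' x))"
    using d1(1) d2(1) by (intro exI[of _ "min d1 d2"]) auto
qed

text \<open>Equations \<open>y' = F x y\<close> whose right-hand side is Lipschitz in \<open>y\<close> with a locally integrable
  constant \<open>a x\<close>. The last assumption replaces the usual measurability condition; for the linear
  systems used here it holds by \<open>locally_integrable_bilinear'\<close>.\<close>
locale caratheodory =
  fixes F :: "real \<Rightarrow> 'a::euclidean_space \<Rightarrow> 'a" and a :: "real \<Rightarrow> real"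
  assumes bound_integrable: "locally_integrable a"
    and lipschitz: "norm (F x y - F x z) \<le> a x * norm (y - z)"
    and zero: "F x 0 = 0"
    and superposition: "continuous_on UNIV h \<Longrightarrow> locally_integrable (\<lambda>x. F x (h x))"
begin

text \<open>With \<open>K\<close> the integral of \<open>a\<close> from \<open>0\<close>, the usual Bielecki weight on a half-line is
  \<open>exp (2 K)\<close>. This symmetric variant serves both directions at once: its integral against
  \<open>a\<close> is half the difference of the two exponentials and hence at most half the weight in modulus.\<close>
definition weight :: "real \<Rightarrow> real" where
  "weight x = exp (2 * oriented_integral a x) + exp (- 2 * oriented_integral a x)"

lemma weight_pos: "weight x > 0" and weight_ge_1: "weight x \<ge> 1"
proof -
  show "weight x > 0" by (simp add: weight_def add_pos_pos)
  show "weight x \<ge> 1"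
  proof (cases "oriented_integral a x \<ge> 0")
    case True
    then have "1 + 0 \<le> weight x" unfolding weight_def by (intro add_mono) auto
    then show ?thesis by simp
  next
    case False
    then have "0 + 1 \<le> weight x" unfolding weight_def by (intro add_mono) auto
    then show ?thesis by simp
  qed
qed

lemma continuous_weight: "continuous_on S weight"
proof -
  have "continuous_on UNIV weight"
    unfolding weight_def
    by (intro continuous_intros ac_deriv_continuous[OF ac_deriv_oriented_integral[OF bound_integrable]])
  then show ?thesis by (rule continuous_on_subset) simp
qed

lemma weight_integral:
  shows "locally_integrable (\<lambda>x. a x * weight x)"
    and "\<bar>oriented_integral (\<lambda>x. a x * weight x) x\<bar> \<le> weight x / 2"
proof -
  let ?K = "oriented_integral a"
  have K: "ac_deriv UNIV ?K a"
    by (rule ac_deriv_oriented_integral[OF bound_integrable])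
  have e: "ac_deriv UNIV (\<lambda>x. exp (c * ?K x)) (\<lambda>x. c * a x * exp (c * ?K x))" for c
    by (rule ac_deriv_exp[OF ac_deriv_linear[OF bounded_linear_mult_right K]])
  have "ac_deriv UNIV (\<lambda>x. (exp (2 * ?K x) - exp (- 2 * ?K x)) / 2)
      (\<lambda>x. (2 * a x * exp (2 * ?K x) - (- 2) * a x * exp (- 2 * ?K x)) / 2)"
    by (rule ac_deriv_linear[OF bounded_linear_divide ac_deriv_diff[OF e e]])
  also have "(\<lambda>x. (2 * a x * exp (2 * ?K x) - (- 2) * a x * exp (- 2 * ?K x)) / 2) = (\<lambda>x. a x * weight x)"
    by (simp add: weight_def fun_eq_iff distrib_left flip: distrib_left)
  finally have ac: "ac_deriv UNIV (\<lambda>x. (exp (2 * ?K x) - exp (- 2 * ?K x)) / 2) (\<lambda>x. a x * weight x)" .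
  then show "locally_integrable (\<lambda>x. a x * weight x)" by (simp add: ac_deriv_UNIV)
  have "oriented_integral (\<lambda>x. a x * weight x) x = (exp (2 * ?K x) - exp (- 2 * ?K x)) / 2"
    using ac_deriv_eq_oriented_integral[OF ac, of x] by simp
  moreover have "\<bar>exp (2 * ?K x) - exp (- 2 * ?K x)\<bar> \<le> weight x"
    unfolding weight_def by (smt (verit) exp_gt_zero)
  ultimately show "\<bar>oriented_integral (\<lambda>x. a x * weight x) x\<bar> \<le> weight x / 2"
    by simp
qed

text \<open>In the norm weighted by \<open>weight\<close> the integral operator of the equation is Lipschitz with
  constant \<open>1/2\<close>, on the whole line. It is stated pointwise with a bound required only between
  \<open>0\<close> and \<open>x\<close>, so that it serves uniqueness too, where no growth bound is available.\<close>
lemma weighted_contraction: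
  assumes y: "continuous_on UNIV y" and z: "continuous_on UNIV z"
    and c: "\<And>s. s \<in> closed_segment 0 x \<Longrightarrow> norm (y s - z s) \<le> c * weight s"
  shows "norm (oriented_integral (\<lambda>s. F s (y s)) x - oriented_integral (\<lambda>s. F s (z s)) x)
      \<le> c * weight x / 2"
proof -
  have c0: "c \<ge> 0"
    using order_trans[OF norm_ge_zero c[of 0]] weight_pos[of 0] by (simp add: zero_le_mult_iff)
  have a_nonneg: "a s \<ge> 0" for s
  proof -
    obtain b :: 'a where "b \<in> Basis" using nonempty_Basis by blast
    then show ?thesis using order_trans[OF norm_ge_zero lipschitz[of s b 0]] by simp
  qed
  have ly: "locally_integrable (\<lambda>s. F s (y s))" and lz: "locally_integrable (\<lambda>s. F s (z s))"
    using superposition y z by auto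
  have "oriented_integral (\<lambda>s. F s (y s)) x - oriented_integral (\<lambda>s. F s (z s)) x
      = oriented_integral (\<lambda>s. F s (y s) - F s (z s)) x"
    by (simp add: oriented_integral_diff ly lz)
  also have "norm \<dots> \<le> \<bar>oriented_integral (\<lambda>s. c * (a s * weight s)) x\<bar>"
  proof (rule norm_oriented_integral_le)
    show "locally_integrable (\<lambda>s. F s (y s) - F s (z s))"
      by (rule locally_integrable_diff[OF ly lz])
    show "locally_integrable (\<lambda>s. c * (a s * weight s))"
      by (rule locally_integrable_linear[OF bounded_linear_mult_right weight_integral(1)])
    fix s assume "s \<in> closed_segment 0 x"
    have "norm (F s (y s) - F s (z s)) \<le> a s * norm (y s - z s)" by (rule lipschitz)
    also have "\<dots> \<le> a s * (c * weight s)"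
      by (rule mult_left_mono[OF c[OF \<open>s \<in> closed_segment 0 x\<close>] a_nonneg])
    finally show "norm (F s (y s) - F s (z s)) \<le> c * (a s * weight s)" by (simp add: ac_simps)
  qed
  also have "\<dots> = c * \<bar>oriented_integral (\<lambda>s. a s * weight s) x\<bar>"
    by (simp add: oriented_integral_cmult abs_mult c0)
  also have "\<dots> \<le> c * (weight x / 2)"
    by (rule mult_left_mono[OF weight_integral(2) c0])
  finally show ?thesis by simp
qed

text \<open>Between \<open>0\<close> and \<open>x0\<close> the weighted distance of the two solutions attains its maximum. By
  the contraction estimate the maximum is at most half of itself.\<close>
theorem solution_unique:
  assumes y: "ac_deriv UNIV y (\<lambda>x. F x (y x))" and z: "ac_deriv UNIV z (\<lambda>x. F x (z x))"
    and init: "y 0 = z 0"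
  shows "y = z"
proof
  fix x0 :: real
  let ?S = "closed_segment 0 x0"
  let ?r = "\<lambda>x. norm (y x - z x) / weight x"
  have cy: "continuous_on UNIV y" and cz: "continuous_on UNIV z"
    using y z ac_deriv_continuous by auto
  have "continuous_on ?S ?r"
    using cy cz continuous_weight weight_pos
    by (intro continuous_intros) (auto intro: continuous_on_subset simp: less_imp_neq[symmetric])
  then obtain m where m: "m \<in> ?S" "\<And>x. x \<in> ?S \<Longrightarrow> ?r x \<le> ?r m"
    using continuous_attains_sup[of ?S ?r] by (auto simp: compact_segment)
  have "norm (y m - z m) = norm (oriented_integral (\<lambda>s. F s (y s)) m - oriented_integral (\<lambda>s. F s (z s)) m)"
    using ac_deriv_eq_oriented_integral[OF y, of m] ac_deriv_eq_oriented_integral[OF z, of m] init by simp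
  also have "\<dots> \<le> ?r m * weight m / 2"
  proof (rule weighted_contraction[OF cy cz])
    fix s assume "s \<in> closed_segment 0 m"
    with m(1) have "s \<in> ?S"
      by (auto simp: closed_segment_eq_real_ivl split: if_splits)
    from m(2)[OF this] show "norm (y s - z s) \<le> ?r m * weight s"
      using weight_pos[of s] by (simp add: field_simps)
  qed
  also have "\<dots> = norm (y m - z m) / 2"
    using weight_pos[of m] by simp
  finally have "?r m = 0" by simp
  then have "?r x0 \<le> 0" using m(2)[of x0] by (metis ends_in_segment(2))
  then show "y x0 = z x0"
    using weight_pos[of x0] by (simp add: divide_le_0_iff)
qed

text \<open>Banach's fixed point theorem in the space of bounded continuous functions. The unknown is
  \<open>h = y / weight\<close>; \<open>P\<close> is the integral operator in terms of \<open>h\<close>, and \<open>Q\<close> divides by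
  the weight again.\<close>
theorem solution_exists:
  "\<exists>y. y 0 = y0 \<and> ac_deriv UNIV y (\<lambda>x. F x (y x))"
proof -
  define P where "P h x = y0 + oriented_integral (\<lambda>s. F s (weight s *\<^sub>R h s)) x" for h x
  define Q where "Q h x = P h x /\<^sub>R weight x" for h x
  have ch: "continuous_on UNIV (\<lambda>s. weight s *\<^sub>R h s)" if "continuous_on UNIV h" for h :: "real \<Rightarrow> 'a"
    using that continuous_weight by (intro continuous_intros)
  have acP: "ac_deriv UNIV (P h) (\<lambda>s. F s (weight s *\<^sub>R h s))" if "continuous_on UNIV h" for h
    using ac_deriv_oriented_integral[OF superposition[OF ch[OF that]]]
    by (simp add: P_def[abs_def] ac_deriv_UNIV)
  have diff: "norm (Q h x - Q k x) \<le> c / 2"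
    if h: "continuous_on UNIV h" and k: "continuous_on UNIV k" and c: "\<And>s. norm (h s - k s) \<le> c" for h k c x
  proof -
    have "norm (P h x - P k x) \<le> c * weight x / 2"
    proof -
      have "norm (weight s *\<^sub>R h s - weight s *\<^sub>R k s) \<le> c * weight s" for s
        using mult_left_mono[OF c[of s], of "weight s"] weight_pos[of s]
        by (simp only: norm_scaleR flip: scaleR_diff_right) (simp add: mult.commute)
      from weighted_contraction[OF ch[OF h] ch[OF k] this] show ?thesis
        by (simp add: P_def)
    qed
    then show ?thesis
      unfolding Q_def scaleR_diff_right[symmetric] norm_scaleR
      using weight_pos[of x] by (simp add: field_simps)
  qed
  have Q0: "norm (Q (\<lambda>_. 0) x) \<le> norm y0" for x
  proof -
    have "P (\<lambda>_. 0) x = y0"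
      by (simp add: P_def zero oriented_integral_def)
    then show ?thesis
      using weight_ge_1[of x] mult_right_mono[of 1 "weight x" "norm y0"]
      by (simp add: Q_def field_simps)
  qed
  have Qb: "Q (apply_bcontfun h) \<in> bcontfun" for h :: "real \<Rightarrow>\<^sub>C 'a"
  proof -
    have "continuous_on UNIV (Q (apply_bcontfun h))"
      unfolding Q_def using ac_deriv_continuous[OF acP[OF continuous_on_apply_bcontfun]]
        continuous_weight weight_pos
      by (intro continuous_intros) (auto simp: less_imp_neq[symmetric])
    moreover obtain c where c: "\<And>s. norm (apply_bcontfun h s) \<le> c"
      using bounded_apply_bcontfun[of h] by (auto simp: bounded_iff)
    have "norm (Q h x) \<le> norm y0 + c / 2" for x
      using diff[of h "\<lambda>_. 0" c x] c Q0[of x] norm_triangle_sub[of "Q h x" "Q (\<lambda>_. 0) x"]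
      by (simp del: continuous_on_apply_bcontfun add: continuous_on_apply_bcontfun)
    then have "bounded (range (Q (apply_bcontfun h)))"
      by (auto simp: bounded_iff)
    ultimately show ?thesis by (simp add: bcontfun_def)
  qed
  have "\<exists>!h. Bcontfun (Q (apply_bcontfun h)) = h"
  proof (rule banach_fix_type[of "1/2"])
    show "\<forall>h k. dist (Bcontfun (Q (apply_bcontfun h))) (Bcontfun (Q (apply_bcontfun k))) \<le> 1 / 2 * dist h k"
    proof (intro allI dist_bound)
      fix h k :: "real \<Rightarrow>\<^sub>C 'a" and x
      have "norm (Q h x - Q k x) \<le> dist h k / 2"
        using dist_bounded[of h _ k] by (intro diff) (auto simp: dist_norm)
      then show "dist (apply_bcontfun (Bcontfun (Q (apply_bcontfun h))) x)
          (apply_bcontfun (Bcontfun (Q (apply_bcontfun k))) x) \<le> 1 / 2 * dist h k"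
        by (simp add: Bcontfun_inverse Qb dist_norm)
    qed
  qed auto
  then obtain h where "Bcontfun (Q (apply_bcontfun h)) = h" by blast
  then have h: "Q (apply_bcontfun h) x = apply_bcontfun h x" for x
    by (metis Bcontfun_inverse Qb)
  have P: "P (apply_bcontfun h) x = weight x *\<^sub>R apply_bcontfun h x" for x
    using weight_pos[of x] by (simp add: Q_def flip: h)
  have "P (apply_bcontfun h) 0 = y0" by (simp add: P_def)
  moreover have "ac_deriv UNIV (P (apply_bcontfun h)) (\<lambda>s. F s (P (apply_bcontfun h) s))"
    using acP[OF continuous_on_apply_bcontfun, of h] unfolding P .
  ultimately show ?thesis by blast
qed

end

section \<open>Fundamental matrices\<close>

lemma mat2_nth [simp]:
  "mat2 a b c d $ 1 $ 1 = a" "mat2 a b c d $ 1 $ 2 = b"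
  "mat2 a b c d $ 2 $ 1 = c" "mat2 a b c d $ 2 $ 2 = d"
  by (simp_all add: mat2_def)

lemmas matrix2_simps = vec_eq_iff forall_2 matrix_matrix_mult_def matrix_vector_mult_def
  sum_2 mat_def dirac_J_def

lemma bounded_bilinear_matrix_mult:
  "bounded_bilinear ((**) :: complex^'n^'m \<Rightarrow> complex^'k^'n \<Rightarrow> complex^'k^'m)"
  unfolding bilinear_conv_bounded_bilinear[symmetric] bilinear_def
  by (auto intro!: linearI simp: vec_eq_iff matrix_matrix_mult_def sum.distrib scaleR_sum_right
      distrib_left distrib_right)

lemma bounded_bilinear_matrix_vector_mult:
  "bounded_bilinear ((*v) :: complex^'n^'m \<Rightarrow> complex^'n \<Rightarrow> complex^'m)"
  unfolding bilinear_conv_bounded_bilinear[symmetric] bilinear_def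
  by (auto intro!: linearI simp: vec_eq_iff matrix_vector_mult_def sum.distrib scaleR_sum_right
      distrib_left distrib_right)

lemma bounded_linear_entry: "bounded_linear (\<lambda>A::complex^'n^'m. A $ i $ j)"
  by (rule bounded_linear_compose[OF bounded_linear_vec_nth bounded_linear_vec_nth])

lemma bounded_linear_mat2:
  "bounded_linear (\<lambda>z. mat2 z 0 0 0)" "bounded_linear (\<lambda>z. mat2 0 z 0 0)"
  "bounded_linear (\<lambda>z. mat2 0 0 z 0)" "bounded_linear (\<lambda>z. mat2 0 0 0 z)"
  by (auto intro!: linearI simp: vec_eq_iff forall_2 simp flip: linear_conv_bounded_linear)

lemma mat2_decompose: "mat2 a b c d = mat2 a 0 0 0 + mat2 0 b 0 0 + mat2 0 0 c 0 + mat2 0 0 0 d"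
  by (simp add: vec_eq_iff forall_2)

lemma locally_integrable_mat2:
  assumes "locally_integrable a" "locally_integrable b" "locally_integrable c" "locally_integrable d"
  shows "locally_integrable (\<lambda>x. mat2 (a x) (b x) (c x) (d x))"
  unfolding mat2_decompose[of "a _" "b _" "c _" "d _"]
  by (intro locally_integrable_add locally_integrable_linear[OF bounded_linear_mat2(1)]
      locally_integrable_linear[OF bounded_linear_mat2(2)] locally_integrable_linear[OF bounded_linear_mat2(3)]
      locally_integrable_linear[OF bounded_linear_mat2(4)] assms)

lemma ac_deriv_mat2:
  assumes "ac_deriv UNIV a a'" "ac_deriv UNIV b b'" "ac_deriv UNIV c c'" "ac_deriv UNIV d d'"
  shows "ac_deriv UNIV (\<lambda>x. mat2 (a x) (b x) (c x) (d x)) (\<lambda>x. mat2 (a' x) (b' x) (c' x) (d' x))"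
  unfolding mat2_decompose[of "a _" "b _" "c _" "d _"] mat2_decompose[of "a' _" "b' _" "c' _" "d' _"]
  by (intro ac_deriv_add ac_deriv_linear[OF bounded_linear_mat2(1)]
      ac_deriv_linear[OF bounded_linear_mat2(2)] ac_deriv_linear[OF bounded_linear_mat2(3)]
      ac_deriv_linear[OF bounded_linear_mat2(4)] assms)

lemma caratheodory_linear_system:
  fixes A :: "real \<Rightarrow> complex^2^2"
  assumes A: "locally_integrable A"
  shows "\<exists>a. caratheodory (\<lambda>x (Y::complex^2^2). A x ** Y) a"
proof -
  interpret b: bounded_bilinear "(**) :: complex^2^2 \<Rightarrow> complex^2^2 \<Rightarrow> complex^2^2"
    by (rule bounded_bilinear_matrix_mult)
  obtain C where C: "\<forall>X Y. norm ((X::complex^2^2) ** (Y::complex^2^2)) \<le> norm X * norm Y * C"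
    using b.bounded ..
  have "caratheodory (\<lambda>x (Y::complex^2^2). A x ** Y) (\<lambda>x. C * norm (A x))"
  proof
    show "locally_integrable (\<lambda>x. C * norm (A x))"
      by (rule locally_integrable_linear[OF bounded_linear_mult_right locally_integrable_norm[OF A]])
    show "norm (A x ** Y - A x ** Z) \<le> C * norm (A x) * norm (Y - Z)" for x and Y Z :: "complex^2^2"
      using C[rule_format, of "A x" "Y - Z"] by (simp add: b.diff_right ac_simps)
    show "locally_integrable (\<lambda>x. A x ** h x)"
      if "continuous_on UNIV h" for h :: "real \<Rightarrow> complex^2^2"
      by (rule locally_integrable_bilinear'[OF bounded_bilinear_matrix_mult A that])
  qed simp
  then show ?thesis by blast
qed

lemma linear_system_unique:
  fixes Y Z :: "real \<Rightarrow> complex^2^2"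
  assumes "locally_integrable A"
    and "ac_deriv UNIV Y (\<lambda>x. A x ** Y x)" "ac_deriv UNIV Z (\<lambda>x. A x ** Z x)" "Y 0 = Z 0"
  shows "Y = Z"
  using caratheodory_linear_system[OF assms(1)] caratheodory.solution_unique[OF _ assms(2-4)] by blast

lemma linear_system_exists:
  fixes Y0 :: "complex^2^2"
  assumes "locally_integrable A"
  shows "\<exists>Y. Y 0 = Y0 \<and> ac_deriv UNIV Y (\<lambda>x. A x ** Y x)"
  using caratheodory_linear_system[OF assms(1)] caratheodory.solution_exists by blast

text \<open>By the product rule, \<open>det Y\<close> has the derivative \<open>trace A * det Y = 0\<close>.\<close>
lemma liouville:
  fixes Y :: "real \<Rightarrow> complex^2^2"
  assumes Y: "ac_deriv UNIV Y (\<lambda>x. A x ** Y x)" and tr: "\<And>x. A x $ 1 $ 1 + A x $ 2 $ 2 = 0"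
  shows "det (Y x) = det (Y 0)"
proof -
  have e: "ac_deriv UNIV (\<lambda>x. Y x $ i $ j) (\<lambda>x. (A x ** Y x) $ i $ j)" for i j
    by (rule ac_deriv_linear[OF bounded_linear_entry Y])
  have "ac_deriv UNIV (\<lambda>x. Y x $ 1 $ 1 * Y x $ 2 $ 2 - Y x $ 1 $ 2 * Y x $ 2 $ 1)
    (\<lambda>x. ((A x ** Y x) $ 1 $ 1 * Y x $ 2 $ 2 + Y x $ 1 $ 1 * (A x ** Y x) $ 2 $ 2)
       - ((A x ** Y x) $ 1 $ 2 * Y x $ 2 $ 1 + Y x $ 1 $ 2 * (A x ** Y x) $ 2 $ 1))"
    by (intro ac_deriv_diff ac_deriv_bilinear[OF bounded_bilinear_mult] e)
  also have "(\<lambda>x. Y x $ 1 $ 1 * Y x $ 2 $ 2 - Y x $ 1 $ 2 * Y x $ 2 $ 1) = (\<lambda>x. det (Y x))"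
    by (simp add: det_2)
  also have "(\<lambda>x. ((A x ** Y x) $ 1 $ 1 * Y x $ 2 $ 2 + Y x $ 1 $ 1 * (A x ** Y x) $ 2 $ 2)
       - ((A x ** Y x) $ 1 $ 2 * Y x $ 2 $ 1 + Y x $ 1 $ 2 * (A x ** Y x) $ 2 $ 1))
     = (\<lambda>x. (A x $ 1 $ 1 + A x $ 2 $ 2) * det (Y x))"
    by (simp add: det_2 matrix_matrix_mult_def sum_2 algebra_simps)
  finally have "ac_deriv UNIV (\<lambda>x. det (Y x)) (\<lambda>x. 0)"
    by (simp add: tr)
  from ac_deriv_eq_oriented_integral[OF this, of x] show ?thesis
    by (simp add: oriented_integral_def)
qed

text \<open>Solving the Dirac equation for the derivative: \<open>mat2 \<i> 0 0 (- \<i>)\<close> is the inverse of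
  \<open>dirac_J\<close>.\<close>
definition dirac_coeff :: "(real \<Rightarrow> complex^2^2) \<Rightarrow> complex \<Rightarrow> real \<Rightarrow> complex^2^2" where
  "dirac_coeff Q lam x = mat2 \<i> 0 0 (- \<i>) ** (mat lam - Q x)"

lemma dirac_equation_iff:
  "dirac_J ** G + Q x ** E = mat lam ** E \<longleftrightarrow> G = dirac_coeff Q lam x ** E"
proof -
  have J: "mat2 \<i> 0 0 (- \<i>) ** dirac_J = mat 1" "dirac_J ** mat2 \<i> 0 0 (- \<i>) = mat 1"
    by (simp_all add: matrix2_simps)
  have "dirac_J ** G + Q x ** E = mat lam ** E \<longleftrightarrow> dirac_J ** G = (mat lam - Q x) ** E"
    by (auto simp: bounded_bilinear.diff_left[OF bounded_bilinear_matrix_mult] algebra_simps)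
  also have "\<dots> \<longleftrightarrow> G = mat2 \<i> 0 0 (- \<i>) ** ((mat lam - Q x) ** E)"
    by (metis J matrix_mul_assoc matrix_mul_lid)
  finally show ?thesis by (simp add: dirac_coeff_def matrix_mul_assoc)
qed

lemma is_fundamental_matrix_iff:
  "is_fundamental_matrix Q lam E \<longleftrightarrow>
    E 0 = mat 1 \<and> ac_deriv UNIV E (\<lambda>x. dirac_coeff Q lam x ** E x)"
  unfolding is_fundamental_matrix_def dirac_equation_iff
proof safe
  fix G assume "ac_deriv UNIV E G" "AE x in lebesgue. G x = dirac_coeff Q lam x ** E x"
  then show "ac_deriv UNIV E (\<lambda>x. dirac_coeff Q lam x ** E x)"
    using ac_deriv_cong_ae[of E G "\<lambda>x. dirac_coeff Q lam x ** E x"] by (simp add: eq_commute)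
qed auto

lemma locally_integrable_dirac_coeff:
  assumes "locally_integrable Q" shows "locally_integrable (dirac_coeff Q lam)"
  unfolding dirac_coeff_def[abs_def]
  by (intro locally_integrable_linear[OF bounded_bilinear.bounded_linear_right[OF bounded_bilinear_matrix_mult]]
      locally_integrable_diff assms locally_integrable_continuous continuous_on_const)

text \<open>The definition of the fundamental matrix by a definite description is meaningful, since
  a solution exists and is unique.\<close>
lemma fundamental_matrix:
  assumes Q: "locally_integrable Q"
  shows "fundamental_matrix Q lam 0 = mat 1"
    and "ac_deriv UNIV (fundamental_matrix Q lam) (\<lambda>x. dirac_coeff Q lam x ** fundamental_matrix Q lam x)"
proof -
  note A = locally_integrable_dirac_coeff[OF Q, of lam]
  obtain E where E: "is_fundamental_matrix Q lam E"
    using linear_system_exists[OF A, of "mat 1"] is_fundamental_matrix_iff by blast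
  have "is_fundamental_matrix Q lam (fundamental_matrix Q lam)"
    unfolding fundamental_matrix_def
  proof (rule theI[of "is_fundamental_matrix Q lam", OF E])
    fix E' assume "is_fundamental_matrix Q lam E'"
    then show "E' = E"
      using E linear_system_unique[OF A] by (simp add: is_fundamental_matrix_iff)
  qed
  then show "fundamental_matrix Q lam 0 = mat 1"
    and "ac_deriv UNIV (fundamental_matrix Q lam) (\<lambda>x. dirac_coeff Q lam x ** fundamental_matrix Q lam x)"
    by (simp_all add: is_fundamental_matrix_iff)
qed

text \<open>Both sides solve the same system, since the coefficients are periodic, and they agree at
  \<open>0\<close>.\<close>
lemma fundamental_matrix_shift:
  assumes Q: "locally_integrable Q" and per: "\<And>x. Q (x + T) = Q x"
  shows "fundamental_matrix Q lam (x + T) = fundamental_matrix Q lam x ** fundamental_matrix Q lam T"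
proof -
  let ?E = "fundamental_matrix Q lam"
  note E = fundamental_matrix[OF Q, of lam]
  have c: "dirac_coeff Q lam (x + T) = dirac_coeff Q lam x" for x
    by (simp add: dirac_coeff_def per)
  have "(\<lambda>x. ?E (x + T)) = (\<lambda>x. ?E x ** ?E T)"
  proof (rule linear_system_unique[OF locally_integrable_dirac_coeff[OF Q]])
    show "ac_deriv UNIV (\<lambda>x. ?E (x + T)) (\<lambda>x. dirac_coeff Q lam x ** ?E (x + T))"
      using ac_deriv_shift[OF E(2), of T] by (simp add: c)
    show "ac_deriv UNIV (\<lambda>x. ?E x ** ?E T) (\<lambda>x. dirac_coeff Q lam x ** (?E x ** ?E T))"
      using ac_deriv_linear[OF bounded_bilinear.bounded_linear_left[OF bounded_bilinear_matrix_mult] E(2), of "?E T"]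
      by (simp add: matrix_mul_assoc)
    show "?E (0 + T) = ?E 0 ** ?E T" by (simp add: E(1))
  qed
  then show ?thesis by (rule fun_cong)
qed

definition cnj_matrix :: "complex^2^2 \<Rightarrow> complex^2^2" where
  "cnj_matrix A = (\<chi> i j. cnj (A $ i $ j))"

lemma cnj_matrix_nth [simp]: "cnj_matrix A $ i $ j = cnj (A $ i $ j)"
  by (simp add: cnj_matrix_def)

lemma cnj_matrix_mult: "cnj_matrix (A ** B) = cnj_matrix A ** cnj_matrix B"
  by (simp add: vec_eq_iff matrix_matrix_mult_def)

lemma bounded_linear_cnj_matrix: "bounded_linear cnj_matrix"
  by (auto intro!: linearI simp: vec_eq_iff simp flip: linear_conv_bounded_linear)

text \<open>Reflection changes the sign of the derivative and conjugation that of \<open>\<i>\<close>. The two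
  together leave the system for real \<open>lam\<close> unchanged, and they preserve the initial value.\<close>
lemma fundamental_matrix_reflect:
  assumes Q: "locally_integrable Q" and pt: "\<And>x. cnj_matrix (Q (- x)) = Q x" and lam: "lam \<in> \<real>"
  shows "cnj_matrix (fundamental_matrix Q lam (- x)) = fundamental_matrix Q lam x"
proof -
  let ?E = "fundamental_matrix Q lam"
  note E = fundamental_matrix[OF Q, of lam]
  have c: "- cnj_matrix (dirac_coeff Q lam (- x) ** B) = dirac_coeff Q lam x ** cnj_matrix B" for x B
  proof -
    have "cnj_matrix (mat lam - Q (- x)) = mat lam - Q x"
      using lam pt[of x] by (auto simp: vec_eq_iff mat_def Reals_cnj_iff)
    then have "- cnj_matrix (dirac_coeff Q lam (- x)) = dirac_coeff Q lam x"
      unfolding dirac_coeff_def cnj_matrix_mult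
      by (simp add: vec_eq_iff forall_2 matrix_matrix_mult_def sum_2)
    then show ?thesis
      unfolding cnj_matrix_mult
      by (metis bounded_bilinear.minus_left[OF bounded_bilinear_matrix_mult])
  qed
  have "(\<lambda>x. cnj_matrix (?E (- x))) = ?E"
  proof (rule linear_system_unique[OF locally_integrable_dirac_coeff[OF Q] _ E(2)])
    have "ac_deriv UNIV (\<lambda>x. cnj_matrix (?E (- x))) (\<lambda>x. cnj_matrix (- (dirac_coeff Q lam (- x) ** ?E (- x))))"
      by (rule ac_deriv_linear[OF bounded_linear_cnj_matrix ac_deriv_reflect[OF E(2)]])
    then show "ac_deriv UNIV (\<lambda>x. cnj_matrix (?E (- x))) (\<lambda>x. dirac_coeff Q lam x ** cnj_matrix (?E (- x)))"
      by (simp add: linear_neg[OF bounded_linear.linear[OF bounded_linear_cnj_matrix]] c)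
    show "cnj_matrix (?E (- 0)) = ?E 0" by (simp add: E(1) vec_eq_iff mat_def)
  qed
  then show ?thesis by (rule fun_cong)
qed

lemma mat_mult_vec: "mat c *v v = c *s (v::complex^2)"
  by (simp add: vec_eq_iff matrix_vector_mult_def mat_def sum_2 forall_2)

text \<open>The value \<open>N\<close> at \<open>- T\<close> is the inverse of the value \<open>M\<close> at \<open>T\<close>, so by
  \<open>det M = 1\<close> it is the adjugate of \<open>M\<close> and has the same trace. By reflection, \<open>N\<close>
  is also the conjugate of \<open>M\<close>.\<close>
lemma monodromy_trace_real:
  assumes Q: "locally_integrable Q" and per: "\<And>x. Q (x + T) = Q x"
    and pt: "\<And>x. cnj_matrix (Q (- x)) = Q x" and lam: "lam \<in> \<real>"
    and det1: "det (fundamental_matrix Q lam T) = 1"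
  shows "trace (fundamental_matrix Q lam T) \<in> \<real>"
proof -
  define M where "M = fundamental_matrix Q lam T"
  define N where "N = fundamental_matrix Q lam (- T)"
  have "N ** M = mat 1"
    using fundamental_matrix_shift[OF Q per, of lam "- T"] fundamental_matrix(1)[OF Q]
    by (simp add: M_def N_def)
  then have inv: "N$1$1 * M$1$1 + N$1$2 * M$2$1 = 1" "N$1$1 * M$1$2 + N$1$2 * M$2$2 = 0"
    "N$2$1 * M$1$1 + N$2$2 * M$2$1 = 0" "N$2$1 * M$1$2 + N$2$2 * M$2$2 = 1"
    by (simp_all add: matrix2_simps)
  have d: "M$1$1 * M$2$2 - M$1$2 * M$2$1 = 1"
    using det1 by (simp add: M_def det_2)
  have "N$1$1 = M$2$2" "N$2$2 = M$1$1"
    using inv d by algebra+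
  moreover have "cnj_matrix N = M"
    unfolding M_def N_def by (rule fundamental_matrix_reflect[OF Q pt lam])
  ultimately have "cnj (M$1$1 + M$2$2) = M$1$1 + M$2$2"
    using cnj_matrix_nth[of N 1 1] cnj_matrix_nth[of N 2 2] by simp
  then show ?thesis
    by (simp add: trace_def sum_2 M_def Reals_cnj_iff)
qed

text \<open>The characteristic polynomial is \<open>\<rho>\<^sup>2 - \<tau> \<rho> + 1\<close>. Its roots for
  \<open>\<bar>\<tau>\<bar> \<le> 2\<close> are the points of the unit circle with real part \<open>\<tau> / 2\<close>.\<close>
lemma unimodular_eigenvector:
  fixes M :: "complex^2^2"
  assumes det1: "det M = 1" and tr: "trace M = of_real \<tau>" and "\<bar>\<tau>\<bar> \<le> 2"
  obtains \<rho> v where "norm \<rho> = 1" "v \<noteq> 0" "M *v v = \<rho> *s v"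
proof -
  define c where "c = \<tau> / 2"
  have c: "c\<^sup>2 \<le> 1" using assms(3) by (simp add: c_def abs_square_le_1)
  define \<rho> where "\<rho> = Complex c (sqrt (1 - c\<^sup>2))"
  have "norm \<rho> = 1" using c by (simp add: \<rho>_def complex_norm)
  have "\<rho>\<^sup>2 - trace M * \<rho> + 1 = 0"
  proof -
    have "(sqrt (1 - c\<^sup>2))\<^sup>2 = 1 - c\<^sup>2" using c by simp
    moreover have "\<tau> = 2 * c" by (simp add: c_def)
    ultimately show ?thesis
      by (simp add: \<rho>_def tr complex_eq_iff power2_eq_square)
  qed
  then have "det (M - mat \<rho>) = 0"
    using det1 by (simp add: det_2 trace_def sum_2 mat_def algebra_simps power2_eq_square)
  then obtain v where "v \<noteq> 0" "(M - mat \<rho>) *v v = 0"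
    using invertible_det_nz[of "M - mat \<rho>"] matrix_left_invertible_ker[of "M - mat \<rho>"]
    by (metis invertible_left_inverse)
  then have "M *v v = \<rho> *s v"
    by (simp add: matrix_vector_mult_diff_rdistrib mat_mult_vec)
  with \<open>norm \<rho> = 1\<close> \<open>v \<noteq> 0\<close> show ?thesis using that by blast
qed

section \<open>Bounded solutions belong to the spectrum\<close>

lemma integrable_lorentzian:
  fixes \<eta> :: real
  assumes "\<eta> > 0" shows "integrable lebesgue (\<lambda>x. 1 / (1 + (\<eta> * x)\<^sup>2))"
proof -
  have "integrable lborel (\<lambda>x::real. inverse (1 + x\<^sup>2))"
    using integrable_inverse_1_plus_square by (simp add: set_integrable_def)
  from lborel_integrable_real_affine[OF this, of \<eta> 0] have "integrable lborel (\<lambda>x. inverse (1 + (\<eta> * x)\<^sup>2))"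
    using assms by simp
  then show ?thesis
    by (simp add: integrable_completion inverse_eq_divide)
qed

lemma continuous_in_L2:
  assumes y: "continuous_on UNIV y" and k: "integrable lebesgue k" and le: "\<And>x. (norm (y x))\<^sup>2 \<le> k x"
  shows "y \<in> L2 UNIV"
proof -
  have m: "y \<in> borel_measurable lebesgue"
    using y by (simp add: borel_measurable_continuous_onI measurable_completion)
  then have "(\<lambda>x. (norm (y x))\<^sup>2) \<in> borel_measurable lebesgue" by measurable
  then have "integrable lebesgue (\<lambda>x. (norm (y x))\<^sup>2)"
    by (rule Bochner_Integration.integrable_bound[OF k]) (use le in \<open>auto intro: order_trans[OF _ abs_ge_self]\<close>)
  with m show ?thesis by (simp add: L2_def lebesgue_on_UNIV_eq)
qed

lemma L2_norm_mono:
  assumes "y \<in> L2 UNIV" "z \<in> L2 UNIV" "c \<ge> 0" "\<And>x. norm (y x) \<le> c * norm (z x)"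
  shows "L2_norm UNIV y \<le> c * L2_norm UNIV z"
proof -
  have "(norm (y x))\<^sup>2 \<le> c\<^sup>2 * (norm (z x))\<^sup>2" for x
    using power_mono[OF assms(4)[of x], of 2] by (simp add: power_mult_distrib)
  then have "L2_norm UNIV y \<le> sqrt (integral\<^sup>L lebesgue (\<lambda>x. c\<^sup>2 * (norm (z x))\<^sup>2))"
    unfolding L2_norm_def lebesgue_on_UNIV_eq using assms
    by (intro real_sqrt_le_mono integral_mono)
      (auto simp: L2_def lebesgue_on_UNIV_eq)
  also have "\<dots> = c * L2_norm UNIV z"
    using assms(3) by (simp add: L2_norm_def lebesgue_on_UNIV_eq real_sqrt_mult)
  finally show ?thesis .
qed

lemma continuous_L2_norm_pos:
  assumes y: "continuous_on UNIV y" "y \<in> L2 UNIV" and "y x0 \<noteq> 0"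
  shows "L2_norm UNIV y > 0"
proof (rule ccontr)
  assume "\<not> L2_norm UNIV y > 0"
  moreover have "L2_norm UNIV y \<ge> 0" by (simp add: L2_norm_def)
  ultimately have "integral\<^sup>L lebesgue (\<lambda>x. (norm (y x))\<^sup>2) = 0"
    using Bochner_Integration.integral_nonneg[of lebesgue "\<lambda>x. (norm (y x))\<^sup>2"]
    by (simp add: L2_norm_def lebesgue_on_UNIV_eq not_less antisym)
  then have "AE x in lebesgue. y x = 0"
    using y(2) by (subst (asm) integral_nonneg_eq_0_iff_AE) (auto simp: L2_def lebesgue_on_UNIV_eq)
  then have "AE x in lebesgue. x \<in> {x. y x = 0}" by simp
  moreover have "closed {x. y x = 0}"
    using y(1) by (simp add: closed_Collect_eq)
  ultimately have "x0 \<in> {x. y x = 0}" by (rule mem_closed_if_AE_lebesgue[rotated])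
  with assms(3) show False by simp
qed

lemma norm_dirac_J [simp]: "norm (dirac_J *v v) = norm v"
  by (simp add: norm_vec_def L2_set_def sum_2 dirac_J_def matrix_vector_mult_def norm_mult)

lemma smult_scaleR_commute: "c *s (r *\<^sub>R v) = r *\<^sub>R (c *s (v::complex^'n))"
  by (simp add: vec_eq_iff)

lemma norm_smult: "norm (c *s v) = norm c * norm (v::complex^'n)"
  by (simp add: norm_vec_def norm_mult L2_set_right_distrib)

text \<open>If \<open>lam\<close> were in the resolvent set, some \<open>C\<close> would bound the norm of \<open>y\<close> by \<open>C\<close>
  times that of the image of \<open>y\<close> under the operator minus \<open>lam\<close>. Let \<open>y = k u\<close> with the
  scalar function \<open>k x = 1 / (1 + (\<eta> x)\<^sup>2)\<close>. As \<open>u\<close> is a solution, the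
  image is \<open>k' J u\<close>. Moreover \<open>\<bar>k'\<bar> \<le> \<eta> k\<close>, so the image is pointwise bounded by
  \<open>\<eta>\<close> times the norm of \<open>y\<close>. This contradicts the bound once \<open>\<eta> C < 1\<close>.\<close>
theorem bounded_solution_in_spectrum:
  assumes u: "ac_deriv UNIV u g" and eq: "\<And>x. dirac_J *v g x + Q x *v u x = lam *s u x"
    and bounded: "\<And>x. norm (u x) \<le> B" and nonzero: "u x0 \<noteq> 0"
  shows "lam \<in> spectrum_L Q"
proof (rule ccontr)
  assume "lam \<notin> spectrum_L Q"
  then obtain C where C: "\<And>y w. (y, w) \<in> dirac_line Q \<Longrightarrow> L2_norm UNIV y \<le> C * L2_norm UNIV (shifted lam y w)"
    by (auto simp: op_spectrum_def resolvent_set_def) (metis (no_types, lifting) case_prodD)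
  define \<eta> where "\<eta> = 1 / (\<bar>C\<bar> + 1)"
  have \<eta>: "\<eta> > 0" by (simp add: \<eta>_def add_nonneg_pos)
  define k where "k x = 1 / (1 + (\<eta> * x)\<^sup>2)" for x
  define k' where "k' x = - (2 * \<eta>\<^sup>2 * x) / (1 + (\<eta> * x)\<^sup>2)\<^sup>2" for x
  have pos: "1 + (\<eta> * x)\<^sup>2 > 0" for x by (simp add: add_pos_nonneg)
  have k: "k x > 0" "k x \<le> 1" for x
    using pos[of x] by (simp_all add: k_def)
  have slow: "\<bar>k' x\<bar> \<le> \<eta> * k x" for x
  proof -
    have "2 * (\<eta> * \<bar>x\<bar>) \<le> 1 + (\<eta> * x)\<^sup>2"
      using zero_le_power2[of "\<eta> * \<bar>x\<bar> - 1"] by (simp add: power2_eq_square algebra_simps)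
    from mult_left_mono[OF this, of \<eta>] have "2 * \<eta>\<^sup>2 * \<bar>x\<bar> / (1 + (\<eta> * x)\<^sup>2)\<^sup>2 \<le> \<eta> * (1 + (\<eta> * x)\<^sup>2) / (1 + (\<eta> * x)\<^sup>2)\<^sup>2"
      using \<eta> by (intro divide_right_mono) (auto simp: power2_eq_square)
    then show ?thesis
      using pos[of x] \<eta> by (simp add: k_def k'_def abs_mult power2_eq_square)
  qed
  have ck': "continuous_on UNIV k'"
    unfolding k'_def using pos by (intro continuous_intros) (metis less_irrefl power_not_zero)
  have ack: "ac_deriv UNIV k k'"
  proof (rule ac_deriv_of_has_vector_derivative[OF _ ck'])
    show "(k has_vector_derivative k' x) (at x)" for x
      unfolding k_def k'_def has_real_derivative_iff_has_vector_derivative[symmetric]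
      using pos[of x] by (auto intro!: derivative_eq_intros simp: power2_eq_square algebra_simps)
  qed
  define y where "y x = k x *\<^sub>R u x" for x
  define r where "r x = k' x *\<^sub>R (dirac_J *v u x)" for x
  define w where "w x = lam *s y x + r x" for x
  have acy: "ac_deriv UNIV y (\<lambda>x. k' x *\<^sub>R u x + k x *\<^sub>R g x)"
    unfolding y_def by (rule ac_deriv_bilinear[OF bounded_bilinear_scaleR ack u])
  have cy: "continuous_on UNIV y" and cu: "continuous_on UNIV u"
    using ac_deriv_continuous acy u by auto
  have cr: "continuous_on UNIV r"
    unfolding r_def using cu ck'
    by (intro continuous_intros bounded_linear.continuous_on[OF bounded_bilinear.bounded_linear_right[OF bounded_bilinear_matrix_vector_mult]])
  have csm: "continuous_on UNIV (\<lambda>x. lam *s y x)"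
    using bounded_linear.continuous_on[OF bounded_bilinear.bounded_linear_right[OF bounded_bilinear_matrix_vector_mult] cy, of "mat lam"]
    by (simp add: mat_mult_vec)
  have r_le: "norm (r x) \<le> \<eta> * norm (y x)" for x
    using mult_right_mono[OF slow[of x], of "norm (u x)"] k(1)[of x] by (simp add: r_def y_def)
  have y2: "(norm (y x))\<^sup>2 \<le> B\<^sup>2 * k x" for x
  proof -
    have "norm (y x) \<le> k x * B"
      using mult_left_mono[OF bounded[of x], of "k x"] k(1)[of x] by (simp add: y_def)
    then have "(norm (y x))\<^sup>2 \<le> B\<^sup>2 * (k x * k x)"
      using power_mono[of "norm (y x)" "k x * B" 2] by (simp add: power2_eq_square ac_simps)
    also have "\<dots> \<le> B\<^sup>2 * (k x * 1)"
      using k[of x] by (intro mult_left_mono) auto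
    finally show ?thesis by simp
  qed
  have int: "integrable lebesgue (\<lambda>x. c * (B\<^sup>2 * k x))" for c
    unfolding k_def using integrable_lorentzian[OF \<eta>] by (intro integrable_mult_right)
  have yL: "y \<in> L2 UNIV"
    by (rule continuous_in_L2[OF cy int[of 1]]) (use y2 in simp)
  have L: "z \<in> L2 UNIV" if "continuous_on UNIV z" "\<And>x. norm (z x) \<le> c * norm (y x)" for z c
  proof (rule continuous_in_L2[OF that(1) int[of "c\<^sup>2"]])
    fix x
    have "(norm (z x))\<^sup>2 \<le> c\<^sup>2 * (norm (y x))\<^sup>2"
      using power_mono[OF that(2)[of x], of 2] by (simp add: power_mult_distrib)
    also have "\<dots> \<le> c\<^sup>2 * (B\<^sup>2 * k x)" by (rule mult_left_mono[OF y2]) simp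
    finally show "(norm (z x))\<^sup>2 \<le> c\<^sup>2 * (B\<^sup>2 * k x)" .
  qed
  have rL: "r \<in> L2 UNIV" by (rule L[OF cr r_le])
  have "norm (w x) \<le> (norm lam + \<eta>) * norm (y x)" for x
    unfolding w_def using norm_triangle_ineq[of "lam *s y x" "r x"] r_le[of x]
    by (simp add: norm_smult algebra_simps)
  then have wL: "w \<in> L2 UNIV"
    by (intro L[of w]) (auto simp: w_def intro!: continuous_intros csm cr)
  have "w x = dirac_J *v (k' x *\<^sub>R u x + k x *\<^sub>R g x) + Q x *v y x" for x
  proof -
    interpret b: bounded_bilinear "(*v) :: complex^2^2 \<Rightarrow> complex^2 \<Rightarrow> complex^2"
      by (rule bounded_bilinear_matrix_vector_mult)
    have "lam *s y x = k x *\<^sub>R (dirac_J *v g x + Q x *v u x)"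
      by (simp add: y_def eq smult_scaleR_commute)
    then show ?thesis
      by (simp add: w_def r_def y_def b.add_right b.scaleR_right scaleR_add_right)
  qed
  then have "(y, w) \<in> dirac_line Q"
    using acy yL wL unfolding dirac_line_def dirac_max_def by auto
  from C[OF this] have "L2_norm UNIV y \<le> C * L2_norm UNIV (shifted lam y w)" .
  also have "shifted lam y w = r" by (simp add: shifted_def w_def)
  also have "C * L2_norm UNIV r \<le> \<bar>C\<bar> * (\<eta> * L2_norm UNIV y)"
    using L2_norm_mono[OF rL yL less_imp_le[OF \<eta>] r_le]
    by (intro mult_mono) (auto simp: L2_norm_def)
  finally have "(1 - \<bar>C\<bar> * \<eta>) * L2_norm UNIV y \<le> 0" by (simp add: algebra_simps)
  moreover have "1 - \<bar>C\<bar> * \<eta> > 0" by (simp add: \<eta>_def field_simps)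
  moreover have "L2_norm UNIV y > 0"
    by (rule continuous_L2_norm_pos[OF cy yL, of x0]) (use nonzero k(1)[of x0] in \<open>simp add: y_def\<close>)
  ultimately show False by (simp add: mult_le_0_iff)
qed

lemma bounded_of_periodic_norm:
  assumes u: "continuous_on UNIV u" and per: "\<And>x. norm (u (x + T)) = norm (u x)" and "T > 0"
  obtains B where "\<And>x::real. norm (u x) \<le> B"
proof -
  interpret periodic_fun_simple "\<lambda>x. norm (u x)" T
    by standard (rule per)
  have "bounded (u ` {0..T})"
    using u by (meson compact_Icc compact_continuous_image compact_imp_bounded continuous_on_subset subset_UNIV)
  then obtain B where B: "\<And>x. x \<in> {0..T} \<Longrightarrow> norm (u x) \<le> B"
    unfolding bounded_iff by (metis imageI)
  have "norm (u x) \<le> B" for x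
  proof -
    define n where "n = \<lfloor>x / T\<rfloor>"
    have "norm (u x) = norm (u (x - of_int n * T + of_int n * T))" by simp
    also have "\<dots> = norm (u (x - of_int n * T))" by (rule plus_of_int)
    also have "\<dots> \<le> B"
    proof (rule B)
      have "of_int n * T \<le> x" "x < (of_int n + 1) * T"
        using floor_divide_lower[OF \<open>T > 0\<close>, of x] floor_divide_upper[OF \<open>T > 0\<close>, of x]
        by (simp_all add: n_def)
      then show "x - of_int n * T \<in> {0..T}" by (simp add: algebra_simps)
    qed
    finally show ?thesis .
  qed
  then show ?thesis by (rule that)
qed

section \<open>The spectrum is closed\<close>

lemma norm_add_sq_le: "(norm (a + b))\<^sup>2 \<le> 2 * (norm a)\<^sup>2 + 2 * (norm (b::'a::real_normed_vector))\<^sup>2"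
proof -
  have "(norm (a + b))\<^sup>2 \<le> (norm a + norm b)\<^sup>2"
    by (rule power_mono[OF norm_triangle_ineq norm_ge_zero])
  also have "\<dots> \<le> 2 * (norm a)\<^sup>2 + 2 * (norm b)\<^sup>2"
    using sum_squares_bound[of "norm a" "norm b"] by (simp add: power2_sum)
  finally show ?thesis .
qed

lemma L2_norm_nonneg: "L2_norm S y \<ge> 0"
  by (simp add: L2_norm_def)

lemma L2_norm_sq: "(L2_norm S y)\<^sup>2 = integral\<^sup>L (lebesgue_on S) (\<lambda>x. (norm (y x))\<^sup>2)"
  by (simp add: L2_norm_def)

lemma L2_norm_cong_AE:
  assumes "y \<in> L2 S" "z \<in> L2 S" "AE x in lebesgue_on S. y x = z x"
  shows "L2_norm S y = L2_norm S z"
proof -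
  have "integral\<^sup>L (lebesgue_on S) (\<lambda>x. (norm (y x))\<^sup>2) = integral\<^sup>L (lebesgue_on S) (\<lambda>x. (norm (z x))\<^sup>2)"
    using assms unfolding L2_def by (intro integral_cong_AE) auto
  then show ?thesis by (simp add: L2_norm_def)
qed

lemma null_fun_iff_L2_norm:
  assumes "y \<in> L2 S" shows "null_fun S y \<longleftrightarrow> L2_norm S y = 0"
  using assms integral_nonneg_eq_0_iff_AE[of "lebesgue_on S" "\<lambda>x. (norm (y x))\<^sup>2"]
  by (simp add: null_fun_def L2_norm_def L2_def)

lemma smult_measurable:
  assumes "y \<in> borel_measurable M" shows "(\<lambda>x. c *s y x :: complex^2) \<in> borel_measurable M"
proof -
  have "continuous_on UNIV (\<lambda>v::complex^2. mat c *v v)"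
    by (intro linear_continuous_on bounded_bilinear.bounded_linear_right[OF bounded_bilinear_matrix_vector_mult])
  from borel_measurable_continuous_on[OF this assms] show ?thesis
    by (simp add: mat_mult_vec)
qed

lemma L2_add:
  assumes "y \<in> L2 S" "z \<in> L2 S" shows "(\<lambda>x. y x + z x) \<in> L2 S"
    and "(L2_norm S (\<lambda>x. y x + z x))\<^sup>2 \<le> 2 * (L2_norm S y)\<^sup>2 + 2 * (L2_norm S z)\<^sup>2"
proof -
  let ?M = "lebesgue_on S"
  have [measurable]: "y \<in> borel_measurable ?M" "z \<in> borel_measurable ?M"
    and int: "integrable ?M (\<lambda>x. (norm (y x))\<^sup>2)" "integrable ?M (\<lambda>x. (norm (z x))\<^sup>2)"
    using assms by (auto simp: L2_def)
  have i: "integrable ?M (\<lambda>x. 2 * (norm (y x))\<^sup>2 + 2 * (norm (z x))\<^sup>2)"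
    using int by simp
  have i': "integrable ?M (\<lambda>x. (norm (y x + z x))\<^sup>2)"
    by (rule Bochner_Integration.integrable_bound[OF i]) (auto simp: norm_add_sq_le)
  then show "(\<lambda>x. y x + z x) \<in> L2 S" by (simp add: L2_def)
  have "(L2_norm S (\<lambda>x. y x + z x))\<^sup>2 \<le> integral\<^sup>L ?M (\<lambda>x. 2 * (norm (y x))\<^sup>2 + 2 * (norm (z x))\<^sup>2)"
    unfolding L2_norm_sq by (rule integral_mono[OF i' i norm_add_sq_le])
  also have "\<dots> = 2 * (L2_norm S y)\<^sup>2 + 2 * (L2_norm S z)\<^sup>2"
    using int by (simp add: L2_norm_sq)
  finally show "(L2_norm S (\<lambda>x. y x + z x))\<^sup>2 \<le> 2 * (L2_norm S y)\<^sup>2 + 2 * (L2_norm S z)\<^sup>2" .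
qed

lemma L2_smult:
  assumes "y \<in> L2 S" shows "(\<lambda>x. c *s y x) \<in> L2 S"
    and "L2_norm S (\<lambda>x. c *s y x) = norm c * L2_norm S y"
  using assms smult_measurable[of y]
  by (auto simp: L2_def L2_norm_def norm_smult power_mult_distrib real_sqrt_mult)

lemma L2_zero: "(\<lambda>x. 0) \<in> L2 S"
  by (simp add: L2_def)

lemma L2_diff:
  assumes "y \<in> L2 S" "z \<in> L2 S" shows "(\<lambda>x. y x - z x) \<in> L2 S"
    and "(L2_norm S (\<lambda>x. y x - z x))\<^sup>2 \<le> 2 * (L2_norm S y)\<^sup>2 + 2 * (L2_norm S z)\<^sup>2"
  using L2_add[OF assms(1) L2_smult(1)[OF assms(2), of "-1"]] L2_smult(2)[OF assms(2), of "-1"]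
  by simp_all

lemma L2_sum:
  assumes "\<And>k. z k \<in> L2 S" shows "(\<lambda>x. \<Sum>k<N::nat. z k x) \<in> L2 S"
  by (induction N) (simp_all add: L2_zero L2_add(1) assms)

text \<open>Iterating \<open>norm_add_sq_le\<close> replaces the triangle inequality of the \<open>L\<^sub>2\<close>-norm. The
  factors \<open>2 ^ k\<close> are harmless for series whose terms decrease geometrically.\<close>
lemma norm_sum_sq_le:
  fixes a :: "nat \<Rightarrow> 'a::real_normed_vector"
  shows "(norm (\<Sum>k<m. a k))\<^sup>2 \<le> 2 * (\<Sum>k<m. 2 ^ k * (norm (a k))\<^sup>2)"
proof (induction m arbitrary: a)
  case (Suc m)
  have "(norm (\<Sum>k<Suc m. a k))\<^sup>2 \<le> 2 * (norm (a 0))\<^sup>2 + 2 * (norm (\<Sum>k<m. a (Suc k)))\<^sup>2"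
    unfolding sum.lessThan_Suc_shift by (rule norm_add_sq_le)
  also have "\<dots> \<le> 2 * (norm (a 0))\<^sup>2 + 2 * (2 * (\<Sum>k<m. 2 ^ k * (norm (a (Suc k)))\<^sup>2))"
    using Suc.IH[of "\<lambda>k. a (Suc k)"] by simp
  also have "\<dots> = 2 * (\<Sum>k<Suc m. 2 ^ k * (norm (a k))\<^sup>2)"
    unfolding sum.lessThan_Suc_shift by (simp add: sum_distrib_left algebra_simps)
  finally show ?case .
qed simp

text \<open>Summability follows from \<open>norm (a k) \<le> (1/2) ^ k + 2 ^ k (norm (a k))\<^sup>2\<close>: if
  \<open>2 ^ k norm (a k)\<close> is below \<open>1\<close>, the first term dominates, otherwise the second one.
  The estimate of the tail is \<open>norm_sum_sq_le\<close> for the shifted sequence.\<close>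
lemma summable_of_weighted_squares:
  fixes a :: "nat \<Rightarrow> 'a::banach"
  assumes s: "summable (\<lambda>k. 2 ^ k * (norm (a k))\<^sup>2)"
  shows "summable a"
    and "(norm ((\<Sum>k. a k) - (\<Sum>k<N. a k)))\<^sup>2 \<le> 2 * (1/2) ^ N * (\<Sum>k. 2 ^ k * (norm (a k))\<^sup>2)"
proof -
  have "norm (a k) \<le> (1/2) ^ k + 2 ^ k * (norm (a k))\<^sup>2" for k
  proof -
    have "0 \<le> (1/2) ^ k * ((2 ^ k * norm (a k) - 1)\<^sup>2 + 2 ^ k * norm (a k))" by simp
    also have "\<dots> = (1/2) ^ k + 2 ^ k * (norm (a k))\<^sup>2 - norm (a k)"
      by (simp add: power2_eq_square algebra_simps power_one_over)
    finally show ?thesis by simp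
  qed
  then show sa: "summable a"
    using summable_comparison_test'[OF summable_add[OF _ s], of "\<lambda>k. (1/2) ^ k" 0 a]
    by (simp add: summable_geometric)
  let ?S = "\<Sum>k. 2 ^ k * (norm (a k))\<^sup>2"
  have "(norm (\<Sum>k<m. a (k + N)))\<^sup>2 \<le> 2 * (1/2) ^ N * ?S" for m
  proof -
    have "(norm (\<Sum>k<m. a (k + N)))\<^sup>2 \<le> 2 * (\<Sum>k<m. 2 ^ k * (norm (a (k + N)))\<^sup>2)"
      by (rule norm_sum_sq_le)
    also have "\<dots> = 2 * (1/2) ^ N * (\<Sum>k<m. 2 ^ (k + N) * (norm (a (k + N)))\<^sup>2)"
      by (simp add: sum_distrib_left power_add power_one_over)
    also have "\<dots> \<le> 2 * (1/2) ^ N * ?S"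
    proof (rule mult_left_mono)
      have "(\<Sum>k<m. 2 ^ (k + N) * (norm (a (k + N)))\<^sup>2) = (\<Sum>k\<in>{N..<m+N}. 2 ^ k * (norm (a k))\<^sup>2)"
        by (rule sum.reindex_bij_witness[of _ "\<lambda>k. k - N" "\<lambda>k. k + N"]) auto
      also have "\<dots> \<le> ?S" by (rule sum_le_suminf[OF s]) auto
      finally show "(\<Sum>k<m. 2 ^ (k + N) * (norm (a (k + N)))\<^sup>2) \<le> ?S" .
    qed simp
    finally show ?thesis .
  qed
  moreover have "(\<lambda>m. (norm (\<Sum>k<m. a (k + N)))\<^sup>2) \<longlonglongrightarrow> (norm (\<Sum>k. a (k + N)))\<^sup>2"
    by (intro tendsto_intros summable_LIMSEQ) (use sa in \<open>simp add: summable_iff_shift\<close>)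
  ultimately have "(norm (\<Sum>k. a (k + N)))\<^sup>2 \<le> 2 * (1/2) ^ N * ?S"
    by (intro LIMSEQ_le_const2) auto
  then show "(norm ((\<Sum>k. a k) - (\<Sum>k<N. a k)))\<^sup>2 \<le> 2 * (1/2) ^ N * ?S"
    using suminf_minus_initial_segment[OF sa, of N] by simp
qed

text \<open>The part of the completeness of \<open>L\<^sub>2\<close> that a Neumann series needs. The function
  \<open>W = (\<Sum>k. 2 ^ k (norm z\<^sub>k)\<^sup>2)\<close> is integrable and therefore finite almost everywhere. Where it is
  finite, the series converges with a remainder whose square is at most
  \<open>2 (1/2) ^ N W\<close>.\<close>
lemma L2_geometric_series:
  assumes L: "\<And>k. z k \<in> L2 S" and geo: "\<And>k. (L2_norm S (z k))\<^sup>2 \<le> K * (1/4) ^ k"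
  obtains s where "s \<in> L2 S" "(\<lambda>N. (L2_norm S (\<lambda>x. s x - (\<Sum>k<N. z k x)))\<^sup>2) \<longlonglongrightarrow> 0"
proof -
  let ?M = "lebesgue_on S"
  have [measurable]: "z k \<in> borel_measurable ?M" for k using L[of k] by (simp add: L2_def)
  have int: "integrable ?M (\<lambda>x. 2 ^ k * (norm (z k x))\<^sup>2)" for k using L[of k] by (simp add: L2_def)
  have le: "integral\<^sup>L ?M (\<lambda>x. 2 ^ k * (norm (z k x))\<^sup>2) \<le> K * (1/2) ^ k" for k
  proof -
    have "integral\<^sup>L ?M (\<lambda>x. 2 ^ k * (norm (z k x))\<^sup>2) = 2 ^ k * (L2_norm S (z k))\<^sup>2"
      by (simp add: L2_norm_sq)
    also have "\<dots> \<le> 2 ^ k * (K * (1/4) ^ k)" by (rule mult_left_mono[OF geo]) simp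
    also have "\<dots> = K * (2 * (1/4)) ^ k" by (simp only: power_mult_distrib ac_simps)
    finally show ?thesis by simp
  qed
  have sum_int: "summable (\<lambda>k. integral\<^sup>L ?M (\<lambda>x. norm (2 ^ k * (norm (z k x))\<^sup>2)))"
    by (rule summable_comparison_test'[where N = 0 and g = "\<lambda>k. K * (1/2) ^ k"])
      (use le in \<open>auto intro!: summable_mult summable_geometric Bochner_Integration.integral_nonneg\<close>)
  have "(\<integral>\<^sup>+x. (\<Sum>k. ennreal (2 ^ k * (norm (z k x))\<^sup>2)) \<partial>?M)
      = (\<Sum>k. \<integral>\<^sup>+x. ennreal (2 ^ k * (norm (z k x))\<^sup>2) \<partial>?M)"
    by (rule nn_integral_suminf) measurable
  also have "\<dots> = (\<Sum>k. ennreal (integral\<^sup>L ?M (\<lambda>x. 2 ^ k * (norm (z k x))\<^sup>2)))"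
    by (intro suminf_cong nn_integral_eq_integral int) auto
  also have "\<dots> < \<infinity>"
    using sum_int by (subst suminf_ennreal2) (auto simp: Bochner_Integration.integral_nonneg)
  finally have "AE x in ?M. (\<Sum>k. ennreal (2 ^ k * (norm (z k x))\<^sup>2)) \<noteq> \<infinity>"
    by (intro nn_integral_PInf_AE) auto
  then have ae: "AE x in ?M. summable (\<lambda>k. 2 ^ k * (norm (z k x))\<^sup>2)"
    by eventually_elim (auto intro!: summable_suminf_not_top)
  define W where "W x = (\<Sum>k. 2 ^ k * (norm (z k x))\<^sup>2)" for x
  have W: "integrable ?M W"
    unfolding W_def by (rule integrable_suminf[OF int _ sum_int]) (use ae in simp)
  define s where "s x = (\<Sum>k. z k x)" for x
  have [measurable]: "s \<in> borel_measurable ?M" unfolding s_def by measurable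
  have tail: "AE x in ?M. (norm (s x - (\<Sum>k<N. z k x)))\<^sup>2 \<le> 2 * (1/2) ^ N * W x" for N
    using ae unfolding s_def W_def by eventually_elim (rule summable_of_weighted_squares(2))
  have tail_int: "integrable ?M (\<lambda>x. (norm (s x - (\<Sum>k<N. z k x)))\<^sup>2)" for N
    by (rule Bochner_Integration.integrable_bound[OF integrable_mult_right[OF W, of "2 * (1/2) ^ N"]])
      (use tail[of N] in \<open>auto elim!: eventually_mono intro: order_trans[OF _ abs_ge_self]\<close>)
  have "s \<in> L2 S"
    using tail_int[of 0] by (simp add: L2_def)
  moreover have "(\<lambda>N. (L2_norm S (\<lambda>x. s x - (\<Sum>k<N. z k x)))\<^sup>2) \<longlonglongrightarrow> 0"
  proof (rule tendsto_sandwich[OF _ _ tendsto_const])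
    show "\<forall>\<^sub>F N in sequentially. (L2_norm S (\<lambda>x. s x - (\<Sum>k<N. z k x)))\<^sup>2 \<le> 2 * (1/2) ^ N * integral\<^sup>L ?M W"
    proof (intro always_eventually allI)
      fix N
      have "(L2_norm S (\<lambda>x. s x - (\<Sum>k<N. z k x)))\<^sup>2 \<le> integral\<^sup>L ?M (\<lambda>x. 2 * (1/2) ^ N * W x)"
        unfolding L2_norm_sq by (rule integral_mono_AE[OF tail_int integrable_mult_right[OF W] tail])
      then show "(L2_norm S (\<lambda>x. s x - (\<Sum>k<N. z k x)))\<^sup>2 \<le> 2 * (1/2) ^ N * integral\<^sup>L ?M W"
        by simp
    qed
    have "(\<lambda>N. 2 * (1/2) ^ N * integral\<^sup>L ?M W) \<longlonglongrightarrow> 2 * 0 * integral\<^sup>L ?M W"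
      by (intro tendsto_intros LIMSEQ_power_zero) auto
    then show "(\<lambda>N. 2 * (1/2) ^ N * integral\<^sup>L ?M W) \<longlonglongrightarrow> 0" by simp
  qed simp
  ultimately show ?thesis by (rule that)
qed

text \<open>Closure under \<open>y + c y'\<close> with \<open>w + c w'\<close> expresses additivity and homogeneity in one
  condition, which is applied with \<open>c = -1\<close> for differences.\<close>
definition linear_operator_graph :: "real set \<Rightarrow> (vfun \<times> vfun) set \<Rightarrow> bool" where
  "linear_operator_graph S G \<longleftrightarrow> G \<subseteq> L2 S \<times> L2 S \<and> ((\<lambda>x. 0), (\<lambda>x. 0)) \<in> G \<and>
    (\<forall>y w y' w' c. (y, w) \<in> G \<and> (y', w') \<in> G \<longrightarrow> ((\<lambda>x. y x + c *s y' x), (\<lambda>x. w x + c *s w' x)) \<in> G)"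

text \<open>For a right-hand side \<open>z\<close> let \<open>R\<close> be the resolvent at \<open>lam0\<close> and \<open>q = lam - lam0\<close>. The
  Neumann series \<open>s = \<Sum>k. (q R)\<^sup>k z\<close> converges, as the operator \<open>q R\<close> has norm at most \<open>1/2\<close>,
  and \<open>y = R s\<close> is the required preimage: the operator minus \<open>lam\<close> maps it to
  \<open>s - q R s = z\<close>. As \<open>R\<close> is bounded and linear up to null functions, \<open>q R s = s - z\<close>
  follows by passing to the limit in the partial sums. The a priori bound at \<open>lam\<close> results from the one at \<open>lam0\<close> by absorbing
  \<open>q y\<close>.\<close>
lemma resolvent_set_perturb:
  assumes G: "linear_operator_graph S G" and C: "C > 0" and near: "2 * C * norm (lam - lam0) \<le> 1"
    and surj: "\<And>z. z \<in> L2 S \<Longrightarrow> \<exists>(y, w) \<in> G. AE x in lebesgue_on S. shifted lam0 y w x = z x"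
    and bound: "\<And>y w. (y, w) \<in> G \<Longrightarrow> L2_norm S y \<le> C * L2_norm S (shifted lam0 y w)"
  shows "lam \<in> resolvent_set S G"
proof -
  define q where "q = lam - lam0"
  have q: "(C * norm q)\<^sup>2 \<le> 1 / 4"
    using power_mono[of "C * norm q" "1/2" 2] near C by (simp add: q_def power_divide)
  have GL: "y \<in> L2 S" "w \<in> L2 S" if "(y, w) \<in> G" for y w
    using G that by (auto simp: linear_operator_graph_def)
  have Gadd: "((\<lambda>x. y x + c *s y' x), (\<lambda>x. w x + c *s w' x)) \<in> G" if "(y, w) \<in> G" "(y', w') \<in> G" for y w y' w' c
    using G that unfolding linear_operator_graph_def by blast
  have sL: "shifted l y w \<in> L2 S" if "(y, w) \<in> G" for l y w
    using L2_diff(1)[OF GL(2)[OF that] L2_smult(1)[OF GL(1)[OF that]]] by (simp add: shifted_def)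
  have sq: "(L2_norm S y)\<^sup>2 \<le> C\<^sup>2 * (L2_norm S (shifted lam0 y w))\<^sup>2" if "(y, w) \<in> G" for y w
    using power_mono[OF bound[OF that] L2_norm_nonneg, of 2] by (simp add: power_mult_distrib)
  have stable: "L2_norm S y \<le> 2 * C * L2_norm S (shifted lam y w)" if "(y, w) \<in> G" for y w
  proof -
    have "shifted lam0 y w = (\<lambda>x. shifted lam y w x + q *s y x)"
      by (simp add: shifted_def q_def fun_eq_iff vec_eq_iff algebra_simps)
    then have "(L2_norm S (shifted lam0 y w))\<^sup>2
        \<le> 2 * (L2_norm S (shifted lam y w))\<^sup>2 + 2 * (norm q)\<^sup>2 * (L2_norm S y)\<^sup>2"
      using L2_add(2)[OF sL[OF that] L2_smult(1)[OF GL(1)[OF that]], of lam q] L2_smult(2)[OF GL(1)[OF that], of q]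
      by (simp add: power_mult_distrib)
    from order_trans[OF sq[OF that] mult_left_mono[OF this, of "C\<^sup>2"]]
    have "(L2_norm S y)\<^sup>2 \<le> 2 * C\<^sup>2 * (L2_norm S (shifted lam y w))\<^sup>2 + 2 * (C * norm q)\<^sup>2 * (L2_norm S y)\<^sup>2"
      by (simp add: algebra_simps power_mult_distrib)
    moreover have "2 * (C * norm q)\<^sup>2 * (L2_norm S y)\<^sup>2 \<le> 1 / 2 * (L2_norm S y)\<^sup>2"
      using q by (intro mult_right_mono) auto
    ultimately have "(L2_norm S y)\<^sup>2 \<le> (2 * C * L2_norm S (shifted lam y w))\<^sup>2"
      by (simp add: power_mult_distrib)
    then show ?thesis
      by (rule power2_le_imp_le) (use C in \<open>simp add: L2_norm_nonneg\<close>)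
  qed
  have "\<exists>(y, w) \<in> G. AE x in lebesgue_on S. shifted lam y w x = z x" if z: "z \<in> L2 S" for z
  proof -
    obtain R where R: "\<And>z. z \<in> L2 S \<Longrightarrow> R z \<in> G"
      and Rz: "\<And>z. z \<in> L2 S \<Longrightarrow> AE x in lebesgue_on S. shifted lam0 (fst (R z)) (snd (R z)) x = z x"
    proof -
      have "\<forall>z. \<exists>p. z \<in> L2 S \<longrightarrow> p \<in> G \<and> (AE x in lebesgue_on S. shifted lam0 (fst p) (snd p) x = z x)"
        using surj by fastforce
      from choice[OF this] show ?thesis using that by blast
    qed
    have GR: "(fst (R z), snd (R z)) \<in> G" if "z \<in> L2 S" for z using R[OF that] by simp
    define a where "a k = ((\<lambda>z x. q *s fst (R z) x) ^^ k) z" for k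
    have a0: "a 0 = z" and aSuc: "a (Suc k) = (\<lambda>x. q *s fst (R (a k)) x)" for k
      by (simp_all add: a_def)
    have aL: "a k \<in> L2 S" for k
      by (induction k) (simp_all add: a0 aSuc z L2_smult(1) GL(1)[OF GR])
    have geo: "(L2_norm S (a k))\<^sup>2 \<le> (L2_norm S z)\<^sup>2 * (1/4) ^ k" for k
    proof (induction k)
      case (Suc k)
      have "(L2_norm S (a (Suc k)))\<^sup>2 = (norm q)\<^sup>2 * (L2_norm S (fst (R (a k))))\<^sup>2"
        by (simp add: aSuc L2_smult(2)[OF GL(1)[OF GR[OF aL]]] power_mult_distrib)
      also have "\<dots> \<le> (norm q)\<^sup>2 * (C\<^sup>2 * (L2_norm S (shifted lam0 (fst (R (a k))) (snd (R (a k)))))\<^sup>2)"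
        by (rule mult_left_mono[OF sq[OF GR[OF aL]]]) simp
      also have "L2_norm S (shifted lam0 (fst (R (a k))) (snd (R (a k)))) = L2_norm S (a k)"
        by (rule L2_norm_cong_AE[OF sL[OF GR[OF aL]] aL Rz[OF aL]])
      also have "(norm q)\<^sup>2 * (C\<^sup>2 * (L2_norm S (a k))\<^sup>2) = (C * norm q)\<^sup>2 * (L2_norm S (a k))\<^sup>2"
        by (simp add: power_mult_distrib)
      also have "\<dots> \<le> 1/4 * ((L2_norm S z)\<^sup>2 * (1/4) ^ k)"
        by (rule mult_mono[OF q Suc.IH]) auto
      finally show ?case by simp
    qed (simp add: a0)
    obtain s where s: "s \<in> L2 S" and lim: "(\<lambda>N. (L2_norm S (\<lambda>x. s x - (\<Sum>k<N. a k x)))\<^sup>2) \<longlonglongrightarrow> 0"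
      using L2_geometric_series[OF aL geo] by blast
    define y w where "y = fst (R s)" and "w = snd (R s)"
    have yw: "(y, w) \<in> G" using GR[OF s] by (simp add: y_def w_def)
    define e where "e x = q *s y x - (s x - z x)" for x
    have eL: "e \<in> L2 S"
      unfolding e_def by (intro L2_diff(1) L2_smult(1) GL(1)[OF yw] s z)
    have e_le: "(L2_norm S e)\<^sup>2 \<le> 2 * (norm q)\<^sup>2 * C\<^sup>2 * (L2_norm S (\<lambda>x. s x - (\<Sum>k<N. a k x)))\<^sup>2
        + 2 * (L2_norm S (\<lambda>x. s x - (\<Sum>k<Suc N. a k x)))\<^sup>2" for N
    proof -
      define yN wN where "yN x = y x - (\<Sum>k<N. fst (R (a k)) x)"
        and "wN x = w x - (\<Sum>k<N. snd (R (a k)) x)" for x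
      have GN: "(\<lambda>x. y x - (\<Sum>k<n. fst (R (a k)) x), \<lambda>x. w x - (\<Sum>k<n. snd (R (a k)) x)) \<in> G" for n
      proof (induction n)
        case (Suc n)
        from Gadd[OF Suc GR[OF aL[of n]], of "-1"] show ?case
          by (simp add: algebra_simps)
      qed (simp add: yw)
      then have yNG: "(yN, wN) \<in> G" by (simp add: yN_def[abs_def] wN_def[abs_def])
      have "AE x in lebesgue_on S. \<forall>k<N. shifted lam0 (fst (R (a k))) (snd (R (a k))) x = a k x"
        by (intro AE_all_countable[THEN iffD2] allI) (use Rz[OF aL] in \<open>auto elim: eventually_mono\<close>)
      then have "AE x in lebesgue_on S. shifted lam0 yN wN x = s x - (\<Sum>k<N. a k x)"
        using Rz[OF s]
      proof eventually_elim
        case (elim x)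
        have "shifted lam0 yN wN x = shifted lam0 y w x - (\<Sum>k<N. shifted lam0 (fst (R (a k))) (snd (R (a k))) x)"
          by (simp add: shifted_def yN_def wN_def sum_subtractf vec_eq_iff sum_distrib_left algebra_simps)
        with elim show ?case by (simp add: y_def w_def)
      qed
      then have n1: "L2_norm S (shifted lam0 yN wN) = L2_norm S (\<lambda>x. s x - (\<Sum>k<N. a k x))"
        by (intro L2_norm_cong_AE sL[OF yNG] L2_diff(1) s L2_sum aL)
      have "(\<Sum>k<Suc N. a k x) = z x + q *s (\<Sum>k<N. fst (R (a k)) x)" for x
        by (simp add: sum.lessThan_Suc_shift a0 aSuc vec_eq_iff sum_distrib_left del: sum.lessThan_Suc)
      then have "e = (\<lambda>x. q *s yN x - (s x - (\<Sum>k<Suc N. a k x)))"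
        by (simp add: fun_eq_iff e_def yN_def vec_eq_iff algebra_simps del: sum.lessThan_Suc)
      then have "(L2_norm S e)\<^sup>2 \<le> 2 * (L2_norm S (\<lambda>x. q *s yN x))\<^sup>2 + 2 * (L2_norm S (\<lambda>x. s x - (\<Sum>k<Suc N. a k x)))\<^sup>2"
        using L2_diff(2)[OF L2_smult(1)[OF GL(1)[OF yNG], of q] L2_diff(1)[OF s L2_sum[of a S "Suc N", OF aL]]] by simp
      moreover have "(L2_norm S (\<lambda>x. q *s yN x))\<^sup>2 \<le> (norm q)\<^sup>2 * (C\<^sup>2 * (L2_norm S (\<lambda>x. s x - (\<Sum>k<N. a k x)))\<^sup>2)"
        using mult_left_mono[OF sq[OF yNG], of "(norm q)\<^sup>2"]
        by (simp add: L2_smult(2)[OF GL(1)[OF yNG]] power_mult_distrib n1)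
      ultimately show ?thesis by (simp add: ac_simps)
    qed
    have "(\<lambda>N. 2 * (norm q)\<^sup>2 * C\<^sup>2 * (L2_norm S (\<lambda>x. s x - (\<Sum>k<N. a k x)))\<^sup>2
        + 2 * (L2_norm S (\<lambda>x. s x - (\<Sum>k<Suc N. a k x)))\<^sup>2) \<longlonglongrightarrow> 2 * (norm q)\<^sup>2 * C\<^sup>2 * 0 + 2 * 0"
      by (intro tendsto_intros lim LIMSEQ_Suc[OF lim])
    then have "(L2_norm S e)\<^sup>2 \<le> 2 * (norm q)\<^sup>2 * C\<^sup>2 * 0 + 2 * 0"
      by (rule LIMSEQ_le_const) (use e_le in blast)
    then have "null_fun S e"
      by (simp add: null_fun_iff_L2_norm[OF eL])
    then have "AE x in lebesgue_on S. e x = 0"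
      by (simp add: null_fun_def)
    then have "AE x in lebesgue_on S. shifted lam y w x = z x"
      using Rz[OF s]
    proof eventually_elim
      case (elim x)
      then show ?case
        by (simp add: e_def shifted_def q_def y_def w_def vec_eq_iff algebra_simps)
    qed
    with yw show ?thesis by blast
  qed
  moreover have "null_fun S y" if "(y, w) \<in> G" "null_fun S (shifted lam y w)" for y w
    using stable[OF that(1)] that(2) L2_norm_nonneg[of S y]
    by (simp add: null_fun_iff_L2_norm[OF sL[OF that(1)]] null_fun_iff_L2_norm[OF GL(1)[OF that(1)]])
  ultimately show ?thesis
    using stable unfolding resolvent_set_def by (auto intro!: exI[of _ "2 * C"])
qed

theorem closed_op_spectrum:
  assumes "linear_operator_graph S G" shows "closed (op_spectrum S G)"
proof -
  have "open (resolvent_set S G)"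
    unfolding open_dist
  proof
    fix lam0 assume lam0: "lam0 \<in> resolvent_set S G"
    then obtain C where C: "\<And>y w. (y, w) \<in> G \<Longrightarrow> L2_norm S y \<le> C * L2_norm S (shifted lam0 y w)"
      unfolding resolvent_set_def by (auto simp: split_beta) (metis fst_conv snd_conv)
    define D where "D = \<bar>C\<bar> + 1"
    have "D > 0" by (simp add: D_def)
    have bound: "L2_norm S y \<le> D * L2_norm S (shifted lam0 y w)" if "(y, w) \<in> G" for y w
      by (rule order_trans[OF C[OF that] mult_right_mono]) (auto simp: D_def L2_norm_nonneg)
    have "lam \<in> resolvent_set S G" if "dist lam lam0 < 1 / (2 * D)" for lam
    proof (rule resolvent_set_perturb[OF assms \<open>D > 0\<close> _ _ bound])
      show "2 * D * norm (lam - lam0) \<le> 1"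
        using that \<open>D > 0\<close> by (simp add: dist_norm field_simps)
    qed (use lam0 in \<open>auto simp: resolvent_set_def\<close>)
    then show "\<exists>e>0. \<forall>lam. dist lam lam0 < e \<longrightarrow> lam \<in> resolvent_set S G"
      using \<open>D > 0\<close> by (intro exI[of _ "1 / (2 * D)"]) auto
  qed
  then show ?thesis by (simp add: op_spectrum_def closed_def)
qed

lemma linear_operator_graph_dirac_line: "linear_operator_graph UNIV (dirac_line Q)"
  unfolding linear_operator_graph_def
proof (intro conjI allI impI)
  show "dirac_line Q \<subseteq> L2 UNIV \<times> L2 UNIV"
    by (auto simp: dirac_line_def dirac_max_def)
  have "ac_deriv UNIV (\<lambda>x. 0 :: complex^2) (\<lambda>x. 0)"
    by (simp add: ac_deriv_def)
  then show "((\<lambda>x. 0), (\<lambda>x. 0)) \<in> dirac_line Q"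
    by (auto simp: dirac_line_def dirac_max_def L2_zero intro!: exI[of _ "\<lambda>x. 0"])
  fix y w y' w' c assume "(y, w) \<in> dirac_line Q \<and> (y', w') \<in> dirac_line Q"
  then obtain g g' where L: "y \<in> L2 UNIV" "w \<in> L2 UNIV" "y' \<in> L2 UNIV" "w' \<in> L2 UNIV"
    and ac: "ac_deriv UNIV y g" "ac_deriv UNIV y' g'"
    and ae: "AE x in lebesgue_on UNIV. w x = dirac_J *v g x + Q x *v y x"
      "AE x in lebesgue_on UNIV. w' x = dirac_J *v g' x + Q x *v y' x"
    by (auto simp: dirac_line_def dirac_max_def)
  note lin = bounded_bilinear.bounded_linear_right[OF bounded_bilinear_matrix_vector_mult, of "mat c"]
  have "ac_deriv UNIV (\<lambda>x. y x + c *s y' x) (\<lambda>x. g x + c *s g' x)"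
    using ac_deriv_add[OF ac(1) ac_deriv_linear[OF lin ac(2)]] by (simp add: mat_mult_vec)
  moreover have "AE x in lebesgue_on UNIV. w x + c *s w' x
      = dirac_J *v (g x + c *s g' x) + Q x *v (y x + c *s y' x)"
    using ae
    by eventually_elim (simp add: vec_eq_iff matrix_vector_mult_def sum_2 forall_2 algebra_simps)
  ultimately show "((\<lambda>x. y x + c *s y' x), (\<lambda>x. w x + c *s w' x)) \<in> dirac_line Q"
    using L unfolding dirac_line_def dirac_max_def by (auto intro!: L2_add(1) L2_smult(1))
qed

section \<open>The gauge transformation and the bands of the spectrum\<close>

text \<open>The hypotheses on the entries of the potential. In this locale \<open>P\<close> is the given potential
  and \<open>Q\<close> the associated off-diagonal one.\<close>
locale pt_symmetric_potential =
  fixes p1 p2 p3 p4 :: "real \<Rightarrow> complex"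
  assumes loc_integrable: "p \<in> {p1, p2, p3, p4} \<Longrightarrow> loc_integrable p"
    and periodic: "p \<in> {p1, p2, p3, p4} \<Longrightarrow> p (x + pi) = p x"
    and pt_symmetric: "p \<in> {p1, p2, p3, p4} \<Longrightarrow> cnj (p (- x)) = p x"
begin

abbreviation \<gamma> :: complex where "\<gamma> \<equiv> gam p1 p4"
abbreviation \<phi> :: "real \<Rightarrow> complex" where "\<phi> \<equiv> phase1 p1 p4"
abbreviation \<psi> :: "real \<Rightarrow> complex" where "\<psi> \<equiv> phase2 p1 p4"
abbreviation P :: "real \<Rightarrow> complex^2^2" where "P \<equiv> potential p1 p2 p3 p4"
abbreviation Q :: "real \<Rightarrow> complex^2^2" where "Q \<equiv> offdiag_potential p1 p2 p3 p4"

lemma locally_integrable: "p \<in> {p1, p2, p3, p4} \<Longrightarrow> locally_integrable p"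
  using loc_integrable by (simp add: loc_integrable_def locally_integrable_def)

lemma integral_from_0_eq: "integral_from_0 p = oriented_integral p"
  by (simp add: fun_eq_iff integral_from_0_def oriented_integral_def)

lemma ac_deriv_integral_from_0:
  "p \<in> {p1, p2, p3, p4} \<Longrightarrow> ac_deriv UNIV (integral_from_0 p) p"
  unfolding integral_from_0_eq by (rule ac_deriv_oriented_integral[OF locally_integrable])

lemma integral_from_0_shift:
  assumes "p \<in> {p1, p2, p3, p4}"
  shows "integral_from_0 p (x + pi) = integral_from_0 p x + integral_from_0 p pi"
proof -
  have "ac_deriv UNIV (\<lambda>x. integral_from_0 p (x + pi)) p"
    using ac_deriv_shift[OF ac_deriv_integral_from_0[OF assms], of pi] by (simp add: periodic[OF assms])
  from ac_deriv_eq_oriented_integral[OF this, of x] show ?thesis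
    by (simp add: integral_from_0_eq)
qed

lemma integral_from_0_reflect:
  assumes "p \<in> {p1, p2, p3, p4}"
  shows "cnj (integral_from_0 p (- x)) = - integral_from_0 p x"
proof -
  have "ac_deriv UNIV (\<lambda>x. cnj (integral_from_0 p (- x))) (\<lambda>x. cnj (- p (- x)))"
    by (rule ac_deriv_linear[OF bounded_linear_cnj ac_deriv_reflect[OF ac_deriv_integral_from_0[OF assms]]])
  then have "ac_deriv UNIV (\<lambda>x. - cnj (integral_from_0 p (- x))) p"
    using ac_deriv_linear[OF bounded_linear_minus[OF bounded_linear_ident]]
    by (fastforce simp: pt_symmetric[OF assms])
  from ac_deriv_eq_oriented_integral[OF this, of x] show ?thesis
    by (simp add: integral_from_0_eq) (metis minus_minus)
qed

text \<open>By periodicity the integral from \<open>0\<close> to \<open>- \<pi>\<close> is minus the one from \<open>0\<close> to \<open>\<pi>\<close>, by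
  symmetry it is minus the conjugate of that.\<close>
lemma integral_from_0_period_real:
  assumes "p \<in> {p1, p2, p3, p4}" shows "integral_from_0 p pi \<in> \<real>"
proof -
  have "integral_from_0 p (- pi) = - integral_from_0 p pi"
    using integral_from_0_shift[OF assms, of "- pi"] by (simp add: integral_from_0_eq add_eq_0_iff2)
  then show ?thesis
    using integral_from_0_reflect[OF assms, of pi] by (simp add: Reals_cnj_iff)
qed

lemma gam_eq: "2 * of_real pi * \<gamma> = integral_from_0 p1 pi + integral_from_0 p4 pi"
proof -
  have "integral {0..pi} (\<lambda>x. p1 x + p4 x) = integral {0..pi} p1 + integral {0..pi} p4"
    by (intro Henstock_Kurzweil_Integration.integral_add locally_integrable_integrable locally_integrable) auto
  then show ?thesis by (simp add: gam_def integral_from_0_def)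
qed

lemma gam_real: "\<gamma> \<in> \<real>"
proof -
  have "\<gamma> = (integral_from_0 p1 pi + integral_from_0 p4 pi) / (2 * of_real pi)"
    using gam_eq by (simp add: field_simps)
  then show ?thesis
    by (simp add: integral_from_0_period_real Reals_add Reals_divide Reals_mult)
qed

lemma phase_deriv: "ac_deriv UNIV \<phi> (\<lambda>x. \<gamma> - p1 x)" "ac_deriv UNIV \<psi> (\<lambda>x. p4 x - \<gamma>)"
proof -
  have l: "ac_deriv UNIV (\<lambda>x. \<gamma> * of_real x) (\<lambda>x. \<gamma>)"
    by (rule ac_deriv_of_has_vector_derivative)
      (auto intro!: derivative_eq_intros continuous_intros simp: has_vector_derivative_def scaleR_conv_of_real)
  show "ac_deriv UNIV \<phi> (\<lambda>x. \<gamma> - p1 x)" "ac_deriv UNIV \<psi> (\<lambda>x. p4 x - \<gamma>)"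
    unfolding phase1_def[abs_def] phase2_def[abs_def]
    by (intro ac_deriv_diff l ac_deriv_integral_from_0; simp)+
qed

lemma phase_reflect: "cnj (\<phi> (- x)) = - \<phi> x" "cnj (\<psi> (- x)) = - \<psi> x"
  using gam_real by (auto simp: phase1_def phase2_def integral_from_0_reflect Reals_cnj_iff)

text \<open>The constant \<open>\<gamma>\<close> is the mean that makes the two phases increase by the same amount over a
  period. This makes the off-diagonal potential periodic.\<close>
lemma phase_period_eq: "\<psi> pi = \<phi> pi"
  using gam_eq by (simp add: phase1_def phase2_def algebra_simps)

lemma phase_period_real: "\<phi> pi \<in> \<real>"
  using gam_real by (simp add: phase1_def integral_from_0_period_real Reals_diff Reals_mult)

lemma phase_shift: "\<phi> (x + pi) = \<phi> x + \<phi> pi" "\<psi> (x + pi) = \<psi> x + \<phi> pi"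
proof -
  show "\<phi> (x + pi) = \<phi> x + \<phi> pi"
    using integral_from_0_shift[of p1 x] by (simp add: phase1_def algebra_simps)
  have "\<psi> (x + pi) = \<psi> x + \<psi> pi"
    using integral_from_0_shift[of p4 x] by (simp add: phase2_def algebra_simps)
  then show "\<psi> (x + pi) = \<psi> x + \<phi> pi"
    by (simp add: phase_period_eq)
qed

lemma locally_integrable_offdiag: "locally_integrable Q"
proof -
  have c: "continuous_on UNIV \<phi>" "continuous_on UNIV \<psi>"
    using phase_deriv ac_deriv_continuous by auto
  have "locally_integrable (\<lambda>x. p2 x * exp (\<i> * (\<psi> x - \<phi> x)))"
    "locally_integrable (\<lambda>x. p3 x * exp (\<i> * (\<phi> x - \<psi> x)))"
    by (intro locally_integrable_bilinear'[OF bounded_bilinear_mult] locally_integrable continuous_intros c; simp)+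
  moreover have "locally_integrable (\<lambda>x. 0 :: complex)"
    by (intro locally_integrable_continuous continuous_intros)
  ultimately show ?thesis
    unfolding offdiag_potential_def[abs_def] by (intro locally_integrable_mat2)
qed

lemma offdiag_periodic: "Q (x + pi) = Q x"
  by (simp add: offdiag_potential_def phase_shift periodic)

lemma offdiag_pt_symmetric: "cnj_matrix (Q (- x)) = Q x"
  by (simp add: offdiag_potential_def vec_eq_iff forall_2 pt_symmetric exp_cnj phase_reflect algebra_simps)

abbreviation monodromy :: "complex \<Rightarrow> complex^2^2" where
  "monodromy lam \<equiv> fundamental_matrix Q lam pi"

lemma det_monodromy: "det (monodromy lam) = 1"
proof -
  have "det (monodromy lam) = det (fundamental_matrix Q lam 0)"
    by (rule liouville[OF fundamental_matrix(2)[OF locally_integrable_offdiag]])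
      (simp add: dirac_coeff_def offdiag_potential_def matrix_matrix_mult_def sum_2 mat_def)
  then show ?thesis
    by (simp add: fundamental_matrix(1)[OF locally_integrable_offdiag])
qed

lemma trace_monodromy_real: "lam \<in> \<real> \<Longrightarrow> trace (monodromy lam) \<in> \<real>"
  by (rule monodromy_trace_real[OF locally_integrable_offdiag offdiag_periodic offdiag_pt_symmetric _ det_monodromy])

text \<open>The choice \<open>t = 0\<close> is the simplest one; \<open>t\<close> enters \<open>f\<close> through a unimodular factor only.\<close>
lemma char_rem_eq: "char_rem Q 0 lam = trace (monodromy lam) / 2 - cos (of_real pi * lam)"
proof -
  have "det (M - mat 1) = det M - trace M + 1" for M :: "complex^2^2"
    by (simp add: det_2 trace_def sum_2 mat_def algebra_simps)
  then show ?thesis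
    by (simp add: char_rem_def char_det_def det_monodromy diff_divide_distrib)
qed

text \<open>The derivatives of the phases cancel the diagonal entries of the potential except for the
  constant \<open>\<gamma>\<close>, and the exponential factors in the off-diagonal entries are the quotients of the
  entries of \<open>D\<close>.\<close>
lemma gauge_transformation:
  fixes y :: "real \<Rightarrow> complex^2"
  assumes y: "ac_deriv UNIV y (\<lambda>x. dirac_coeff Q lam x *v y x)"
  defines "D \<equiv> \<lambda>x. mat2 (exp (\<i> * \<phi> x)) 0 0 (exp (\<i> * \<psi> x))"
  obtains g where "ac_deriv UNIV (\<lambda>x. D x *v y x) g"
    "\<And>x. dirac_J *v g x + P x *v (D x *v y x) = (lam + \<gamma>) *s (D x *v y x)"
proof
  define D' where "D' x = mat2 (\<i> * (\<gamma> - p1 x) * exp (\<i> * \<phi> x)) 0 0 (\<i> * (p4 x - \<gamma>) * exp (\<i> * \<psi> x))" for x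
  have e: "ac_deriv UNIV (\<lambda>x. exp (\<i> * \<phi> x)) (\<lambda>x. \<i> * (\<gamma> - p1 x) * exp (\<i> * \<phi> x))"
    "ac_deriv UNIV (\<lambda>x. exp (\<i> * \<psi> x)) (\<lambda>x. \<i> * (p4 x - \<gamma>) * exp (\<i> * \<psi> x))"
    by (intro ac_deriv_exp ac_deriv_linear[OF bounded_linear_mult_right] phase_deriv)+
  have z: "ac_deriv UNIV (\<lambda>x. 0 :: complex) (\<lambda>x. 0)"
    by (simp add: ac_deriv_def)
  have "ac_deriv UNIV D D'"
    unfolding D_def D'_def[abs_def] by (intro ac_deriv_mat2 e z)
  then show "ac_deriv UNIV (\<lambda>x. D x *v y x) (\<lambda>x. D' x *v y x + D x *v (dirac_coeff Q lam x *v y x))"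
    by (rule ac_deriv_bilinear[OF bounded_bilinear_matrix_vector_mult _ y])
  show "dirac_J *v (D' x *v y x + D x *v (dirac_coeff Q lam x *v y x)) + P x *v (D x *v y x)
      = (lam + \<gamma>) *s (D x *v y x)" for x
  proof -
    have "exp (\<i> * \<phi> x) * exp (\<i> * (\<psi> x - \<phi> x)) = exp (\<i> * \<psi> x)"
      "exp (\<i> * \<psi> x) * exp (\<i> * (\<phi> x - \<psi> x)) = exp (\<i> * \<phi> x)"
      by (simp_all add: algebra_simps flip: exp_add)
    moreover have ii: "\<i> * (\<i> * z) = - z" for z by (simp flip: mult.assoc)
    ultimately show ?thesis
      unfolding D_def D'_def
      by (simp add: matrix2_simps dirac_coeff_def offdiag_potential_def potential_def)
        (simp add: algebra_simps ii)
  qed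
qed

text \<open>An eigenvector \<open>v\<close> of the monodromy matrix for an eigenvalue of modulus one is the initial
  value of a solution whose norm is periodic, before and after the gauge transformation.\<close>
theorem in_spectrum_if_trace_small:
  assumes lam: "lam \<in> \<real>" and small: "norm (trace (monodromy lam)) \<le> 2"
  shows "lam + \<gamma> \<in> spectrum_L P"
proof -
  let ?E = "fundamental_matrix Q lam"
  note E = fundamental_matrix[OF locally_integrable_offdiag, of lam]
  obtain \<tau> where \<tau>: "trace (monodromy lam) = of_real \<tau>"
    using trace_monodromy_real[OF lam] by (auto elim: Reals_cases)
  obtain \<rho> v where \<rho>: "norm \<rho> = 1" and v: "v \<noteq> 0" "monodromy lam *v v = \<rho> *s v"
    using unimodular_eigenvector[OF det_monodromy \<tau>] small \<tau> by auto
  define y where "y x = ?E x *v v" for x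
  have y: "ac_deriv UNIV y (\<lambda>x. dirac_coeff Q lam x *v y x)"
    using ac_deriv_linear[OF bounded_bilinear.bounded_linear_left[OF bounded_bilinear_matrix_vector_mult] E(2), of v]
    by (simp add: y_def[abs_def] matrix_vector_mul_assoc)
  define u where "u x = mat2 (exp (\<i> * \<phi> x)) 0 0 (exp (\<i> * \<psi> x)) *v y x" for x
  obtain g where g: "ac_deriv UNIV u g" "\<And>x. dirac_J *v g x + P x *v u x = (lam + \<gamma>) *s u x"
    using gauge_transformation[OF y] unfolding u_def by blast
  have "y (x + pi) = \<rho> *s y x" for x
    unfolding y_def fundamental_matrix_shift[OF locally_integrable_offdiag offdiag_periodic]
    by (simp add: v(2) vector_scalar_commute flip: matrix_vector_mul_assoc)
  then have "u (x + pi) = (\<rho> * exp (\<i> * \<phi> pi)) *s u x" for x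
    by (simp add: u_def phase_shift vec_eq_iff forall_2 matrix_vector_mult_def sum_2 distrib_left exp_add)
  moreover have "norm (exp (\<i> * \<phi> pi)) = 1"
    using phase_period_real by (auto simp: norm_exp_i_times elim: Reals_cases)
  ultimately have "norm (u (x + pi)) = norm (u x)" for x
    by (simp add: norm_smult norm_mult \<rho>)
  then obtain B where B: "\<And>x. norm (u x) \<le> B"
    using bounded_of_periodic_norm[OF ac_deriv_continuous[OF g(1)] _ pi_gt_zero] by blast
  have "u 0 = v"
    by (simp add: u_def y_def E(1) phase1_def phase2_def integral_from_0_eq matrix2_simps)
  with v(1) have "u 0 \<noteq> 0" by simp
  from bounded_solution_in_spectrum[OF g B this] show ?thesis .
qed

end

text \<open>Equivalently, \<open>sin (\<pi> \<epsilon> / 2) \<ge> 3 \<epsilon> / 2\<close>. The sine is concave on \<open>[0, \<pi>]\<close>, and at the end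
  point \<open>\<epsilon> = 1/3\<close> the claim is \<open>sin (\<pi> / 6) = 1/2\<close>.\<close>
lemma cos_pi_le:
  assumes "0 \<le> \<epsilon>" "\<epsilon> \<le> 1 / 3" shows "cos (pi * \<epsilon>) \<le> 1 - 9 / 2 * \<epsilon>\<^sup>2"
proof -
  have cvx: "convex_on {0..pi} (\<lambda>x. - sin x)"
    by (rule f''_ge0_imp_convex[where f' = "\<lambda>x. - cos x" and f'' = sin])
      (auto intro!: derivative_eq_intros sin_ge_zero)
  have "sin ((1 - 3 * \<epsilon>) *\<^sub>R 0 + (3 * \<epsilon>) *\<^sub>R (pi / 6)) \<ge> (1 - 3 * \<epsilon>) * sin 0 + (3 * \<epsilon>) * sin (pi / 6)"
    using convex_onD[OF cvx, of "3 * \<epsilon>" 0 "pi / 6"] assms by simp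
  then have "sin (pi * \<epsilon> / 2) \<ge> 3 * \<epsilon> / 2"
    by (simp add: sin_30 algebra_simps)
  then have "(sin (pi * \<epsilon> / 2))\<^sup>2 \<ge> (3 * \<epsilon> / 2)\<^sup>2"
    using assms by (intro power_mono) auto
  moreover have "cos (pi * \<epsilon>) = 1 - 2 * (sin (pi * \<epsilon> / 2))\<^sup>2"
    using cos_double_sin[of "pi * \<epsilon> / 2"] by simp
  ultimately show ?thesis by (simp add: power_divide power_mult_distrib)
qed

lemma abs_cos_le:
  fixes k :: int
  assumes "0 < \<epsilon>" "\<epsilon> \<le> 1 / 3" and x: "x \<in> {of_int k + \<epsilon> .. of_int k + 1 - \<epsilon>}"
  shows "\<bar>cos (pi * x)\<bar> \<le> 1 - 9 / 2 * \<epsilon>\<^sup>2"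
proof -
  define s where "s = x - of_int k"
  have s: "\<epsilon> \<le> s" "s \<le> 1 - \<epsilon>" using x by (auto simp: s_def)
  have "cos (pi * x) = cos (pi * s + of_int k * pi)" by (simp add: s_def algebra_simps)
  also have "\<dots> = cos (pi * s) * cos (of_int k * pi)"
    by (simp add: cos_add sin_zero_iff_int2)
  finally have "\<bar>cos (pi * x)\<bar> = \<bar>cos (pi * s)\<bar> * \<bar>cos (of_int k * pi)\<bar>" by (simp add: abs_mult)
  also have "\<dots> \<le> \<bar>cos (pi * s)\<bar>" by (simp add: mult_left_le)
  also have "\<dots> \<le> cos (pi * \<epsilon>)"
  proof -
    have "cos (pi * s) \<le> cos (pi * \<epsilon>)"
      using s assms by (intro cos_monotone_0_pi_le) (auto simp: mult_left_le)
    moreover have "cos (pi * (1 - \<epsilon>)) \<le> cos (pi * s)"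
      using s assms by (intro cos_monotone_0_pi_le) (auto simp: mult_left_le)
    moreover have "cos (pi * (1 - \<epsilon>)) = - cos (pi * \<epsilon>)"
      by (simp add: right_diff_distrib)
    ultimately show ?thesis by linarith
  qed
  finally show ?thesis using cos_pi_le[of \<epsilon>] assms by linarith
qed

context pt_symmetric_potential
begin

text \<open>The two families of intervals are treated at once, \<open>j\<close> being the integer at the left end:
  \<open>\<bar>cos (\<pi> l)\<bar>\<close> has period \<open>1\<close> in \<open>l\<close>.\<close>
lemma interval_in_spectrum:
  fixes x :: real and j k :: int
  assumes est: "estimate_at Q \<epsilon> \<delta> k" and e: "0 < \<epsilon> k" "\<epsilon> k \<le> 1 / 3" and j: "j \<in> {2 * k, 2 * k + 1}"
    and x: "x - Re \<gamma> \<in> {of_int j + \<epsilon> k .. of_int j + 1 - \<epsilon> k}"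
  shows "of_real x \<in> spectrum_L P"
proof -
  define l where "l = x - Re \<gamma>"
  have "l \<in> {2 * of_int k .. 2 * of_int k + 2}"
    using x j e by (auto simp: l_def)
  then have "norm (char_rem Q 0 (of_real l)) < \<delta> k"
    using est e unfolding estimate_at_def by auto
  moreover have "\<delta> k < 9 / 2 * (\<epsilon> k)\<^sup>2"
    using est by (simp add: estimate_at_def)
  moreover have "norm (cos (of_real pi * of_real l :: complex)) \<le> 1 - 9 / 2 * (\<epsilon> k)\<^sup>2"
    using abs_cos_le[OF e, of l j] x by (simp add: l_def cos_of_real flip: of_real_mult of_real_diff)
  moreover have "norm (trace (monodromy (of_real l)) / 2)
      \<le> norm (char_rem Q 0 (of_real l)) + norm (cos (of_real pi * of_real l :: complex))"
    unfolding char_rem_eq by (metis diff_add_cancel norm_triangle_ineq)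
  ultimately have "norm (trace (monodromy (of_real l)) / 2) \<le> 1"
    by linarith
  then have "of_real l + \<gamma> \<in> spectrum_L P"
    by (intro in_spectrum_if_trace_small) (auto simp: norm_divide)
  moreover have "of_real l + \<gamma> = of_real x"
    using gam_real by (auto simp: l_def elim!: Reals_cases)
  ultimately show ?thesis by simp
qed

end

section \<open>Density of the spectrum\<close>

text \<open>A point of the complement lies within \<open>\<eta>\<close> of \<open>j + \<gamma>\<close> or \<open>j + 1 + \<gamma>\<close>, where \<open>j\<close> is the
  integer part of \<open>x - \<gamma>\<close>, unless \<open>k = j div 2\<close> is so small that nothing is known about the
  interval.\<close>
lemma complement_in_small_intervals:
  fixes \<epsilon> :: "int \<Rightarrow> real" and K :: int and \<gamma> :: real
  assumes small: "\<And>k. \<bar>k\<bar> > K \<Longrightarrow> \<epsilon> k < \<eta>"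
    and A: "\<And>k j. \<bar>k\<bar> > K \<Longrightarrow> j \<in> {2 * k, 2 * k + 1} \<Longrightarrow>
      {of_int j + \<epsilon> k + \<gamma> <..< of_int j + 1 - \<epsilon> k + \<gamma>} \<subseteq> A"
  shows "{- 2 * s <..< 2 * s} - A \<subseteq> {- (2 * \<bar>K\<bar> + 2 + \<bar>\<gamma>\<bar>) .. 2 * \<bar>K\<bar> + 2 + \<bar>\<gamma>\<bar>} \<union>
    (\<Union>j \<in> {- (\<lceil>2 * s + \<bar>\<gamma>\<bar>\<rceil> + 1) .. \<lceil>2 * s + \<bar>\<gamma>\<bar>\<rceil> + 1}. {of_int j + \<gamma> - \<eta> .. of_int j + \<gamma> + \<eta>})"
proof
  fix x assume x: "x \<in> {- 2 * s <..< 2 * s} - A"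
  define j where "j = \<lfloor>x - \<gamma>\<rfloor>"
  define k where "k = j div 2"
  have j: "of_int j \<le> x - \<gamma>" "x - \<gamma> < of_int j + 1"
    unfolding j_def by linarith+
  have jk: "j \<in> {2 * k, 2 * k + 1}" unfolding k_def by auto
  show "x \<in> {- (2 * \<bar>K\<bar> + 2 + \<bar>\<gamma>\<bar>) .. 2 * \<bar>K\<bar> + 2 + \<bar>\<gamma>\<bar>} \<union>
    (\<Union>j \<in> {- (\<lceil>2 * s + \<bar>\<gamma>\<bar>\<rceil> + 1) .. \<lceil>2 * s + \<bar>\<gamma>\<bar>\<rceil> + 1}. {of_int j + \<gamma> - \<eta> .. of_int j + \<gamma> + \<eta>})"
  proof (cases "\<bar>k\<bar> > K")
    case True
    have n: "2 * s + \<bar>\<gamma>\<bar> \<le> of_int \<lceil>2 * s + \<bar>\<gamma>\<bar>\<rceil>" by linarith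
    have "real_of_int j > of_int (- (\<lceil>2 * s + \<bar>\<gamma>\<bar>\<rceil> + 2))" "real_of_int j < of_int (\<lceil>2 * s + \<bar>\<gamma>\<bar>\<rceil> + 1)"
    proof -
      have "- (2 * s) < x" "x < 2 * s" using x by auto
      then show "real_of_int j > of_int (- (\<lceil>2 * s + \<bar>\<gamma>\<bar>\<rceil> + 2))" "real_of_int j < of_int (\<lceil>2 * s + \<bar>\<gamma>\<bar>\<rceil> + 1)"
        using n j unfolding of_int_minus of_int_add by linarith+
    qed
    then have jr: "- (\<lceil>2 * s + \<bar>\<gamma>\<bar>\<rceil> + 1) \<le> j" "j + 1 \<le> \<lceil>2 * s + \<bar>\<gamma>\<bar>\<rceil> + 1"
      unfolding of_int_less_iff by linarith+
    have "x \<notin> {of_int j + \<epsilon> k + \<gamma> <..< of_int j + 1 - \<epsilon> k + \<gamma>}"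
      using A[OF True jk] x by blast
    then have "x \<in> {of_int j + \<gamma> - \<eta> .. of_int j + \<gamma> + \<eta>}
        \<or> x \<in> {of_int (j + 1) + \<gamma> - \<eta> .. of_int (j + 1) + \<gamma> + \<eta>}"
      using j small[OF True] by auto
    then show ?thesis
    proof
      assume "x \<in> {of_int j + \<gamma> - \<eta> .. of_int j + \<gamma> + \<eta>}"
      then show ?thesis using jr by (intro UnI2 UN_I[of j]) auto
    next
      assume "x \<in> {of_int (j + 1) + \<gamma> - \<eta> .. of_int (j + 1) + \<gamma> + \<eta>}"
      then show ?thesis using jr by (intro UnI2 UN_I[of "j + 1"]) auto
    qed
  next
    case False
    then have "\<bar>j\<bar> \<le> 2 * \<bar>K\<bar> + 1" using jk by auto
    then have "\<bar>real_of_int j\<bar> \<le> 2 * \<bar>of_int K\<bar> + 1" by linarith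
    then show ?thesis using j by auto
  qed
qed

text \<open>The covering of the complement has about \<open>4 s\<close> intervals of length \<open>2 \<eta>\<close> and a bounded
  part, so its measure is at most \<open>8 \<eta> s + c\<close>. Measurability of \<open>A\<close> is essential here, since
  otherwise the complement says nothing about the measure of \<open>A\<close>.\<close>
lemma full_density:
  fixes \<epsilon> :: "int \<Rightarrow> real" and N \<gamma> :: real
  assumes meas: "A \<in> sets lebesgue" and lim: "(\<epsilon> \<longlongrightarrow> 0) (filtercomap abs at_top)"
    and A: "\<And>k j. of_int \<bar>k\<bar> > N \<Longrightarrow> j \<in> {2 * k, 2 * k + 1} \<Longrightarrow>
      {of_int j + \<epsilon> k + \<gamma> <..< of_int j + 1 - \<epsilon> k + \<gamma>} \<subseteq> A"
  shows "((\<lambda>s. measure lebesgue (A \<inter> {- 2 * s <..< 2 * s}) / (4 * s)) \<longlongrightarrow> 1) at_top"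
proof (rule tendstoI)
  fix e :: real assume "e > 0"
  \<comment> \<open>The claim leaves room for a complement of measure \<open>4 e s\<close>. The small intervals take a
    quarter of it, \<open>8 \<eta> s = e s\<close>, and \<open>c\<close> takes at most half of it once \<open>2 e s > c\<close>.\<close>
  define \<eta> where "\<eta> = e / 8"
  have "\<eta> > 0" using \<open>e > 0\<close> by (simp add: \<eta>_def)
  have "\<forall>\<^sub>F k in filtercomap abs at_top. \<epsilon> k < \<eta>"
    by (rule order_tendstoD(2)[OF lim \<open>\<eta> > 0\<close>])
  then obtain K0 where K0: "\<And>k. \<bar>k\<bar> \<ge> K0 \<Longrightarrow> \<epsilon> k < \<eta>"
    by (auto simp: eventually_filtercomap_at_top_linorder)
  define K where "K = max K0 \<lceil>N\<rceil>"
  have small: "\<epsilon> k < \<eta>" if "\<bar>k\<bar> > K" for k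
    using that by (intro K0) (simp add: K_def)
  have large: "of_int \<bar>k\<bar> > N" if "\<bar>k\<bar> > K" for k
  proof -
    have "\<bar>k\<bar> > \<lceil>N\<rceil>" using that by (simp add: K_def)
    then show ?thesis by linarith
  qed
  define R where "R = 2 * \<bar>real_of_int K\<bar> + 2 + \<bar>\<gamma>\<bar>"
  define c where "c = 2 * R + 2 * \<eta> * (2 * \<bar>\<gamma>\<bar> + 5)"
  have lower: "measure lebesgue (A \<inter> {- 2 * s <..< 2 * s}) \<ge> 4 * s - (c + 8 * \<eta> * s)"
    and upper: "measure lebesgue (A \<inter> {- 2 * s <..< 2 * s}) \<le> 4 * s" if "s > 0" for s
  proof -
    let ?I = "{- 2 * s <..< 2 * s}"
    define n where "n = \<lceil>2 * s + \<bar>\<gamma>\<bar>\<rceil> + 1"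
    define J where "J j = {of_int j + \<gamma> - \<eta> .. of_int j + \<gamma> + \<eta>}" for j
    have n: "of_int n \<le> 2 * s + \<bar>\<gamma>\<bar> + 2" "n \<ge> 0"
      using \<open>s > 0\<close> by (simp_all add: n_def) linarith+
    have sub: "?I - A \<subseteq> {-R..R} \<union> (\<Union>j\<in>{-n..n}. J j)"
      using complement_in_small_intervals[OF small A[OF large], where s = s]
      by (simp add: R_def n_def J_def)
    have mI: "measure lebesgue ?I = 4 * s" using \<open>s > 0\<close> by simp
    have "measure lebesgue (?I - A) \<le> measure lebesgue ({-R..R} \<union> (\<Union>j\<in>{-n..n}. J j))"
      using meas by (intro measure_mono_fmeasurable[OF sub]) (auto simp: J_def intro!: lmeasurable_compact compact_Un compact_UN)
    also have "\<dots> \<le> measure lebesgue {-R..R} + measure lebesgue (\<Union>j\<in>{-n..n}. J j)"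
      by (intro measure_Un_le) (auto simp: J_def)
    also have "measure lebesgue {-R..R} = 2 * R" by (simp add: R_def)
    also have "measure lebesgue (\<Union>j\<in>{-n..n}. J j) \<le> (\<Sum>j\<in>{-n..n}. measure lebesgue (J j))"
      by (intro measure_UNION_le) (auto simp: J_def)
    also have "\<dots> = of_int (2 * n + 1) * (2 * \<eta>)"
      using \<open>\<eta> > 0\<close> n(2) by (simp add: J_def)
    also have "\<dots> \<le> (4 * s + 2 * \<bar>\<gamma>\<bar> + 5) * (2 * \<eta>)"
      using n(1) \<open>\<eta> > 0\<close> by (intro mult_right_mono) auto
    finally have le: "measure lebesgue (?I - A) \<le> c + 8 * \<eta> * s"
      by (simp add: c_def algebra_simps)
    have "?I - A = ?I - A \<inter> ?I" by auto
    also have "measure lebesgue \<dots> = measure lebesgue ?I - measure lebesgue (A \<inter> ?I)"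
      using meas by (intro measurable_measure_Diff) auto
    finally have "measure lebesgue (?I - A) = measure lebesgue ?I - measure lebesgue (A \<inter> ?I)" .
    with mI le show "measure lebesgue (A \<inter> ?I) \<ge> 4 * s - (c + 8 * \<eta> * s)" by linarith
    show "measure lebesgue (A \<inter> ?I) \<le> 4 * s"
      unfolding mI[symmetric] using meas by (intro measure_mono_fmeasurable) auto
  qed
  show "\<forall>\<^sub>F s in at_top. dist (measure lebesgue (A \<inter> {- 2 * s <..< 2 * s}) / (4 * s)) 1 < e"
    using eventually_gt_at_top[of "max 0 (c / (2 * e))"]
  proof eventually_elim
    case (elim s)
    then have s: "s > 0" "c < 2 * e * s"
      using \<open>e > 0\<close> by (simp_all add: divide_less_eq mult.commute)
    have "4 * s - measure lebesgue (A \<inter> {- 2 * s <..< 2 * s}) < 4 * s * e"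
    proof -
      have "8 * \<eta> * s = e * s" by (simp add: \<eta>_def)
      moreover have "e * s > 0" using \<open>e > 0\<close> s(1) by simp
      moreover have "c < 2 * (e * s)" using s(2) by (simp only: mult.assoc)
      moreover have "4 * s * e = 4 * (e * s)" by simp
      ultimately show ?thesis
        using lower[OF s(1)] by linarith
    qed
    then show ?case
      using upper[OF s(1)] s(1) \<open>e > 0\<close> by (simp add: dist_real_def abs_if field_simps)
  qed
qed

theorem theorem5:
  fixes p1 p2 p3 p4 :: "real \<Rightarrow> complex"
    and \<epsilon> \<delta> :: "int \<Rightarrow> real" and N :: real
  assumes "\<And>p. p \<in> {p1, p2, p3, p4} \<Longrightarrow> loc_integrable p"
    and "\<And>p x. p \<in> {p1, p2, p3, p4} \<Longrightarrow> p (x + pi) = p x"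
    and "\<And>p x. p \<in> {p1, p2, p3, p4} \<Longrightarrow> cnj (p (- x)) = p x"
    and "admissible_seqs (offdiag_potential p1 p2 p3 p4) \<epsilon> \<delta>"
    and "admissible_const (offdiag_potential p1 p2 p3 p4) \<epsilon> \<delta> N"
  defines "\<gamma> \<equiv> gam p1 p4"
    and "\<sigma> \<equiv> spectrum_L (potential p1 p2 p3 p4)"
  shows "\<gamma> \<in> \<real> \<and>
    (\<forall>k::int. of_int \<bar>k\<bar> > N \<longrightarrow>
       complex_of_real ` {2 * of_int k + \<epsilon> k + Re \<gamma> <..< 2 * of_int k + 1 - \<epsilon> k + Re \<gamma>} \<subseteq> \<sigma> \<and>
       complex_of_real ` {2 * of_int k + 1 + \<epsilon> k + Re \<gamma> <..< 2 * of_int k + 2 - \<epsilon> k + Re \<gamma>} \<subseteq> \<sigma>) \<and>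
    ((\<lambda>s. measure lebesgue ({x. complex_of_real x \<in> \<sigma>} \<inter> {- 2 * s <..< 2 * s}) / (4 * s))
       \<longlongrightarrow> 1) at_top"
proof -
  interpret pt_symmetric_potential p1 p2 p3 p4
    by standard (fact assms(1-3))+
  have interval: "{of_int j + \<epsilon> k + Re \<gamma> <..< of_int j + 1 - \<epsilon> k + Re \<gamma>} \<subseteq> {x. complex_of_real x \<in> \<sigma>}"
    if k: "of_int \<bar>k\<bar> > N" and j: "j \<in> {2 * k, 2 * k + 1}" for j k :: int
  proof
    fix x assume "x \<in> {of_int j + \<epsilon> k + Re \<gamma> <..< of_int j + 1 - \<epsilon> k + Re \<gamma>}"
    then have x: "x - Re \<gamma> \<in> {of_int j + \<epsilon> k .. of_int j + 1 - \<epsilon> k}" by auto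
    have "\<epsilon> k > 0" "estimate_at (offdiag_potential p1 p2 p3 p4) \<epsilon> \<delta> k" "\<epsilon> k \<le> 1 / 3"
      using assms(4,5) k unfolding admissible_seqs_def admissible_const_def by auto
    then show "x \<in> {x. complex_of_real x \<in> \<sigma>}"
      using interval_in_spectrum[of \<epsilon> \<delta> k j x] j x unfolding \<gamma>_def \<sigma>_def by blast
  qed
  have "closed \<sigma>"
    unfolding \<sigma>_def by (rule closed_op_spectrum[OF linear_operator_graph_dirac_line])
  then have "closed (complex_of_real -` \<sigma>)"
    by (rule closed_vimage) (intro continuous_intros)
  then have meas: "{x. complex_of_real x \<in> \<sigma>} \<in> sets lebesgue"
    by (simp add: vimage_def borel_closed sets_completionI_sets)
  have "(\<epsilon> \<longlongrightarrow> 0) (filtercomap abs at_top)"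
    using assms(4) by (simp add: admissible_seqs_def)
  from full_density[OF meas this interval]
  have lim: "((\<lambda>s. measure lebesgue ({x. complex_of_real x \<in> \<sigma>} \<inter> {- 2 * s <..< 2 * s}) / (4 * s))
       \<longlongrightarrow> 1) at_top" .
  have "complex_of_real ` {2 * of_int k + \<epsilon> k + Re \<gamma> <..< 2 * of_int k + 1 - \<epsilon> k + Re \<gamma>} \<subseteq> \<sigma>"
    "complex_of_real ` {2 * of_int k + 1 + \<epsilon> k + Re \<gamma> <..< 2 * of_int k + 2 - \<epsilon> k + Re \<gamma>} \<subseteq> \<sigma>"
    if "of_int \<bar>k\<bar> > N" for k :: int
    using interval[OF that, of "2 * k"] interval[OF that, of "2 * k + 1"]
    by (auto simp: image_subset_iff subset_iff algebra_simps)
  moreover have "\<gamma> \<in> \<real>" unfolding \<gamma>_def by (rule gam_real)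
  ultimately show ?thesis using lim by blast
qed

end
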